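(* Let $F\subset\mathbb{R}^2_{\geq}$ be a (non-degenerate) triangle with rational vertices, and let $\mathcal{P}=\bigcup_{i=0}^{\infty}(iF)\cap\mathbb{N}^2$ be its associated affine convex polygonal semigroup. Then $\mathcal{P}$ is Buchsbaum.
   Context: Here $\mathbb{N}$ contains $0$, $\mathbb{R}^2_{\geq}$ is the set of points with nonnegative coordinates, a triangle means the full convex hull of its three vertices, and $iF=\{ix\mid x\in F\}$. An affine semigroup is a finitely generated submonoid of $\mathbb{N}^2$. Let $\Bbbk$ be a field. The semigroup ring $\Bbbk[S]$ of an affine semigroup $S\subset\mathbb{N}^2$ is the subring of $\Bbbk[t_1,t_2]$ generated by the monomials $t_1^{s_1}t_2^{s_2}$ with $(s_1,s_2)\in S$; $S$ is called Buchsbaum if $\Bbbk[S]$ is a Buchsbaum ring. *)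

theory Defs
  imports
    "HOL-Analysis.Analysis"
    "HOL-Algebra.Algebra"
    "HOL-Algebra.Algebraic_Closure_Type"
    "HOL-Library.Poly_Mapping"
    "HOL-Library.Product_Plus"
    "HOL-Library.Extended_Nat"
begin

section \<open>Localization of a commutative ring\<close>

definition fraction_rel :: "('a, 'b) ring_scheme \<Rightarrow> 'a set \<Rightarrow> (('a \<times> 'a) \<times> ('a \<times> 'a)) set" where
  "fraction_rel R S = {((a, s), (b, t)). a \<in> carrier R \<and> s \<in> S \<and> b \<in> carrier R \<and> t \<in> S \<and>
     (\<exists>u \<in> S. u \<otimes>\<^bsub>R\<^esub> (a \<otimes>\<^bsub>R\<^esub> t \<ominus>\<^bsub>R\<^esub> b \<otimes>\<^bsub>R\<^esub> s) = \<zero>\<^bsub>R\<^esub>)}"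

definition fraction :: "('a, 'b) ring_scheme \<Rightarrow> 'a set \<Rightarrow> 'a \<Rightarrow> 'a \<Rightarrow> ('a \<times> 'a) set" where
  "fraction R S a s = fraction_rel R S `` {(a, s)}"

text \<open>
  The ring of fractions of \<open>R\<close> by a multiplicative set \<open>S \<subseteq> carrier R\<close>; the
  unions below are over equal sets, as the operations respect \<^const>\<open>fraction_rel\<close>.
\<close>

definition localization :: "('a, 'b) ring_scheme \<Rightarrow> 'a set \<Rightarrow> ('a \<times> 'a) set ring" where
  "localization R S = \<lparr>
     carrier = (carrier R \<times> S) // fraction_rel R S,
     monoid.mult = (\<lambda>P Q. \<Union>x \<in> P. \<Union>y \<in> Q.
       fraction R S (fst x \<otimes>\<^bsub>R\<^esub> fst y) (snd x \<otimes>\<^bsub>R\<^esub> snd y)),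
     monoid.one = fraction R S \<one>\<^bsub>R\<^esub> \<one>\<^bsub>R\<^esub>,
     ring.zero = fraction R S \<zero>\<^bsub>R\<^esub> \<one>\<^bsub>R\<^esub>,
     ring.add = (\<lambda>P Q. \<Union>x \<in> P. \<Union>y \<in> Q.
       fraction R S (fst x \<otimes>\<^bsub>R\<^esub> snd y \<oplus>\<^bsub>R\<^esub> fst y \<otimes>\<^bsub>R\<^esub> snd x) (snd x \<otimes>\<^bsub>R\<^esub> snd y))\<rparr>"

section \<open>Buchsbaum rings\<close>

definition prime_chain :: "('a, 'b) ring_scheme \<Rightarrow> nat \<Rightarrow> (nat \<Rightarrow> 'a set) \<Rightarrow> bool" where
  "prime_chain R n p \<longleftrightarrow> (\<forall>i \<le> n. primeideal (p i) R) \<and> (\<forall>i < n. p i \<subset> p (Suc i))"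

definition krull_dim :: "('a, 'b) ring_scheme \<Rightarrow> enat" where
  "krull_dim R = Sup {enat n | n. \<exists>p. prime_chain R n p}"

text \<open>
  In a Noetherian local ring with maximal ideal \<open>m\<close>: as many elements of \<open>m\<close> as the dimension,
  generating an ideal whose radical is \<open>m\<close>.
\<close>

definition system_of_parameters :: "('a, 'b) ring_scheme \<Rightarrow> 'a set \<Rightarrow> 'a list \<Rightarrow> bool" where
  "system_of_parameters A m xs \<longleftrightarrow>
     set xs \<subseteq> m \<and> enat (length xs) = krull_dim A \<and>
     {y \<in> carrier A. \<exists>n::nat. y [^]\<^bsub>A\<^esub> n \<in> Idl\<^bsub>A\<^esub> (set xs)} = m"

definition colon :: "('a, 'b) ring_scheme \<Rightarrow> 'a set \<Rightarrow> 'a \<Rightarrow> 'a set" where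
  "colon A I x = {a \<in> carrier A. a \<otimes>\<^bsub>A\<^esub> x \<in> I}"

text \<open>\<open>m ((x\<^sub>1, \<dots>, x\<^sub>i) : x\<^sub>i\<^sub>+\<^sub>1) \<subseteq> (x\<^sub>1, \<dots>, x\<^sub>i)\<close> for every \<open>i\<close>.\<close>

definition weak_sequence :: "('a, 'b) ring_scheme \<Rightarrow> 'a set \<Rightarrow> 'a list \<Rightarrow> bool" where
  "weak_sequence A m xs \<longleftrightarrow>
     (\<forall>i < length xs. \<forall>y \<in> m. \<forall>a \<in> colon A (Idl\<^bsub>A\<^esub> (set (take i xs))) (xs ! i).
        y \<otimes>\<^bsub>A\<^esub> a \<in> Idl\<^bsub>A\<^esub> (set (take i xs)))"

definition buchsbaum_local_ring :: "('a, 'b) ring_scheme \<Rightarrow> bool" where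
  "buchsbaum_local_ring A \<longleftrightarrow>
     cring A \<and> noetherian_ring A \<and> (\<exists>!m. maximalideal m A) \<and>
     (\<forall>m xs. maximalideal m A \<and> system_of_parameters A m xs \<longrightarrow> weak_sequence A m xs)"

definition buchsbaum_ring :: "('a, 'b) ring_scheme \<Rightarrow> bool" where
  "buchsbaum_ring R \<longleftrightarrow>
     cring R \<and> noetherian_ring R \<and>
     (\<forall>m. maximalideal m R \<longrightarrow> buchsbaum_local_ring (localization R (carrier R - m)))"

section \<open>Affine semigroups in the plane and their semigroup rings\<close>

definition add_submonoid :: "(nat \<times> nat) set \<Rightarrow> bool" where
  "add_submonoid S \<longleftrightarrow> 0 \<in> S \<and> (\<forall>x \<in> S. \<forall>y \<in> S. x + y \<in> S)"

definition affine_semigroup :: "(nat \<times> nat) set \<Rightarrow> bool" where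
  "affine_semigroup S \<longleftrightarrow> (\<exists>G. finite G \<and> S = add_submonoid hull G)"

text \<open>
  The type \<open>(nat \<times> nat) \<Rightarrow>\<^sub>0 'k\<close> is the polynomial ring in two variables \<open>t\<^sub>1, t\<^sub>2\<close> over \<open>'k\<close>:
  \<open>Poly_Mapping.single s c\<close> is \<open>c t\<^sub>1\<^bsup>fst s\<^esup> t\<^sub>2\<^bsup>snd s\<^esup>\<close>, and multiplication is convolution. The
  constants are among the generators, so the result is a subalgebra over \<open>'k\<close>.
\<close>

definition semigroup_ring :: "(nat \<times> nat) set \<Rightarrow> ((nat \<times> nat) \<Rightarrow>\<^sub>0 'k::field) ring" where
  "semigroup_ring S = ring_of_type_algebra
     \<lparr>carrier := generate_ring ring_of_type_algebra
        (range (Poly_Mapping.single 0) \<union> (\<lambda>s. Poly_Mapping.single s 1) ` S)\<rparr>"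

definition buchsbaum_semigroup :: "'k::field itself \<Rightarrow> (nat \<times> nat) set \<Rightarrow> bool" where
  "buchsbaum_semigroup _ S \<longleftrightarrow>
     affine_semigroup S \<and> buchsbaum_ring (semigroup_ring S :: ((nat \<times> nat) \<Rightarrow>\<^sub>0 'k) ring)"

section \<open>The semigroup of a plane figure\<close>

definition rational_point :: "real \<times> real \<Rightarrow> bool" where
  "rational_point x \<longleftrightarrow> fst x \<in> \<rat> \<and> snd x \<in> \<rat>"

text \<open>Non-collinearity of \<open>{a, b, c}\<close> also forces the three vertices to be distinct.\<close>

definition rational_triangle :: "(real \<times> real) set \<Rightarrow> bool" where
  "rational_triangle F \<longleftrightarrow>
     (\<exists>a b c. rational_point a \<and> rational_point b \<and> rational_point c \<and>
        \<not> collinear {a, b, c} \<and> F = convex hull {a, b, c})"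

definition nonneg_quadrant :: "(real \<times> real) set" where
  "nonneg_quadrant = {x. 0 \<le> fst x \<and> 0 \<le> snd x}"

definition convex_body_semigroup :: "(real \<times> real) set \<Rightarrow> (nat \<times> nat) set" where
  "convex_body_semigroup F =
     (\<Union>i::nat. {p. (real (fst p), real (snd p)) \<in> (\<lambda>x. real i *\<^sub>R x) ` F})"

end

theory Submission
  imports Defs
begin

text \<open>
  The ring is even Cohen--Macaulay. Order the vertices as \<open>u, v, w\<close> so that \<open>u\<close> and \<open>v\<close> are linearly
  independent and \<open>w\<close> lies in the cone they span, and let \<open>n1\<close>, \<open>n2\<close> be integral multiples of
  \<open>u\<close>, \<open>v\<close>. The semigroup \<open>P\<close> has the exchange property: if \<open>x + i n1 = z + j n2\<close> with
  \<open>x, z \<in> P\<close>, then \<open>x - j n2 \<in> P\<close>. Hence a nonzero polynomial in \<open>t\<^bsup>n1\<^esup>\<close> and a nonzero polynomial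
  in \<open>t\<^bsup>n2\<^esup>\<close> always form a regular sequence.

  Any three elements of the ring are algebraically dependent over the field. Peeling off lowest terms of a
  relation along a chain of primes \<open>p0 \<subset> p1 \<subset> p2\<close> shows that \<open>p2\<close> contains a nonzero polynomial in
  any prescribed element, and that no chain is longer. So a maximal ideal at which the local ring has dimension
  two contains a regular sequence of the above kind, all powers of which are again regular; this makes every
  system of parameters there a regular sequence. In dimension at most one it suffices that the ring is a domain.
\<close>

section \<open>Localization of a domain\<close>

text \<open>The Buchsbaum condition is imposed at every maximal ideal, including those that contain
  no monomial; there \<open>t^n1\<close> and \<open>t^n2\<close> become units. This is why nonzero
  polynomials in \<open>t^n1\<close> and in \<open>t^n2\<close> take the place of the two monomials.
  Behind their regularity is the freeness of the ring over the subring generated by these monomials;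
  division with remainder makes it concrete. Powers of such polynomials have the same shape, which
  matters because the radical of a parameter ideal only provides some power of an element.

  The vertices \<open>u\<close> and \<open>v\<close> span the rays that bound the cone over the
  triangle, and rationality provides integral points on these rays. The vertex \<open>w\<close> may
  be the origin, lie on a bounding ray, or lie on either side of the line through \<open>u\<close>
  and \<open>v\<close>; nonnegative coordinates of \<open>w\<close> with respect to \<open>u\<close>
  and \<open>v\<close> cover all these positions at once.

  By definition a system of parameters is as long as the local dimension, so its length turns into a
  prime chain: length three or more contradicts the bound on chains, and length two yields the chain
  from which the two polynomials are taken.\<close>

locale domain_fractions = domain R for R (structure) +
  fixes S :: "'a set"
  assumes S_carrier: "S \<subseteq> carrier R"
    and one_S: "\<one> \<in> S"
    and mult_S: "\<lbrakk>s \<in> S; t \<in> S\<rbrakk> \<Longrightarrow> s \<otimes> t \<in> S"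
    and zero_S: "\<zero> \<notin> S"
begin

abbreviation Loc where "Loc \<equiv> localization R S"
abbreviation frac where "frac \<equiv> fraction R S"

lemma S_closed: "s \<in> S \<Longrightarrow> s \<in> carrier R"
  using S_carrier by auto

lemma S_nonzero: "s \<in> S \<Longrightarrow> s \<noteq> \<zero>"
  using zero_S by auto

text \<open>In a domain whose zero is outside \<open>S\<close>, the auxiliary factor
  \<open>u\<close> of the definition cancels, which leaves plain cross multiplication.\<close>

lemma fraction_rel_iff:
  "((a, s), (b, t)) \<in> fraction_rel R S \<longleftrightarrow>
     a \<in> carrier R \<and> s \<in> S \<and> b \<in> carrier R \<and> t \<in> S \<and> a \<otimes> t = b \<otimes> s"
proof -
  have "(\<exists>u\<in>S. u \<otimes> (a \<otimes> t \<ominus> b \<otimes> s) = \<zero>) \<longleftrightarrow> a \<otimes> t = b \<otimes> s"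
    if "a \<in> carrier R" "s \<in> S" "b \<in> carrier R" "t \<in> S"
  proof -
    have c: "a \<otimes> t \<in> carrier R" "b \<otimes> s \<in> carrier R"
      using that S_closed by auto
    have "u \<otimes> (a \<otimes> t \<ominus> b \<otimes> s) = \<zero> \<longleftrightarrow> a \<otimes> t = b \<otimes> s" if "u \<in> S" for u
      using that S_closed S_nonzero c by (auto simp: integral_iff r_right_minus_eq)
    then show ?thesis
      using one_S by auto
  qed
  then show ?thesis
    by (auto simp: fraction_rel_def)
qed

lemma fraction_rel_equiv: "equiv (carrier R \<times> S) (fraction_rel R S)"
proof (rule equivI)
  show "fraction_rel R S \<subseteq> (carrier R \<times> S) \<times> (carrier R \<times> S)"
    by (auto simp: fraction_rel_iff)
  show "refl_on (carrier R \<times> S) (fraction_rel R S)"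
    by (auto simp: refl_on_def fraction_rel_iff)
  show "sym (fraction_rel R S)"
    by (auto simp: sym_def fraction_rel_iff)
  show "trans (fraction_rel R S)"
  proof (rule transI, clarify)
    fix a s b t c r
    assume "((a, s), (b, t)) \<in> fraction_rel R S" "((b, t), (c, r)) \<in> fraction_rel R S"
    then have *: "a \<in> carrier R" "b \<in> carrier R" "c \<in> carrier R" "s \<in> S" "t \<in> S" "r \<in> S"
      and eq: "a \<otimes> t = b \<otimes> s" "b \<otimes> r = c \<otimes> t"
      by (auto simp: fraction_rel_iff)
    then have k: "s \<in> carrier R" "t \<in> carrier R" "r \<in> carrier R" "t \<noteq> \<zero>"
      using S_closed S_nonzero by auto
    have "t \<otimes> (a \<otimes> r) = (a \<otimes> t) \<otimes> r" using * k by (simp add: m_ac)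
    also have "\<dots> = (b \<otimes> r) \<otimes> s" unfolding eq(1) using * k by (simp add: m_ac)
    also have "\<dots> = t \<otimes> (c \<otimes> s)" unfolding eq(2) using * k by (simp add: m_ac)
    finally have "a \<otimes> r = c \<otimes> s" using * k m_lcancel by auto
    then show "((a, s), (c, r)) \<in> fraction_rel R S" using * by (simp add: fraction_rel_iff)
  qed
qed

lemma fraction_eq_iff:
  assumes "a \<in> carrier R" "s \<in> S" "b \<in> carrier R" "t \<in> S"
  shows "frac a s = frac b t \<longleftrightarrow> a \<otimes> t = b \<otimes> s"
  using eq_equiv_class_iff[OF fraction_rel_equiv, of "(a, s)" "(b, t)"] assms
  by (simp add: fraction_def fraction_rel_iff)

lemma carrier_localization: "carrier Loc = {frac a s | a s. a \<in> carrier R \<and> s \<in> S}"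
  by (auto simp: localization_def quotient_def fraction_def)

lemma fraction_closed: "a \<in> carrier R \<Longrightarrow> s \<in> S \<Longrightarrow> frac a s \<in> carrier Loc"
  by (auto simp: carrier_localization)

lemma localization_cases:
  assumes "x \<in> carrier Loc"
  obtains a s where "a \<in> carrier R" "s \<in> S" "x = frac a s"
  using assms by (auto simp: carrier_localization)

lemma mem_fraction:
  assumes "a \<in> carrier R" "s \<in> S"
  shows "(b, t) \<in> frac a s \<longleftrightarrow> b \<in> carrier R \<and> t \<in> S \<and> a \<otimes> t = b \<otimes> s"
  using assms by (auto simp: fraction_def fraction_rel_iff)

text \<open>The operations of the localization are unions over all representatives. If
  \<open>f\<close> takes the same value on all of them, the union collapses to that value;
  well-definedness of product and sum is reduced to this.\<close>

lemma UN_fraction: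
  assumes ab: "a \<in> carrier R" "s \<in> S" "b \<in> carrier R" "t \<in> S"
    and f: "\<And>a' s' b' t'. \<lbrakk>a' \<in> carrier R; s' \<in> S; b' \<in> carrier R; t' \<in> S;
       a \<otimes> s' = a' \<otimes> s; b \<otimes> t' = b' \<otimes> t\<rbrakk> \<Longrightarrow> f (a', s') (b', t') = f (a, s) (b, t)"
  shows "(\<Union>x \<in> frac a s. \<Union>y \<in> frac b t. f x y) = f (a, s) (b, t)"
proof -
  have "f x y = f (a, s) (b, t)" if "x \<in> frac a s" "y \<in> frac b t" for x y
    using that f[of "fst x" "snd x" "fst y" "snd y"] ab
      mem_fraction[of a s "fst x" "snd x"] mem_fraction[of b t "fst y" "snd y"] by simp
  moreover have "(a, s) \<in> frac a s" "(b, t) \<in> frac b t"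
    using ab by (auto simp: mem_fraction)
  ultimately show ?thesis by blast
qed

lemma mult_fraction:
  assumes "a \<in> carrier R" "s \<in> S" "b \<in> carrier R" "t \<in> S"
  shows "frac a s \<otimes>\<^bsub>Loc\<^esub> frac b t = frac (a \<otimes> b) (s \<otimes> t)"
proof -
  have "(\<Union>x \<in> frac a s. \<Union>y \<in> frac b t. frac (fst x \<otimes> fst y) (snd x \<otimes> snd y))
    = frac (a \<otimes> b) (s \<otimes> t)"
  proof (subst UN_fraction)
    fix a' s' b' t'
    assume h: "a' \<in> carrier R" "s' \<in> S" "b' \<in> carrier R" "t' \<in> S"
      and eq: "a \<otimes> s' = a' \<otimes> s" "b \<otimes> t' = b' \<otimes> t"
    note c = h assms S_closed[OF h(2)] S_closed[OF h(4)] S_closed[OF assms(2)] S_closed[OF assms(4)]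
    have "(a' \<otimes> b') \<otimes> (s \<otimes> t) = (a' \<otimes> s) \<otimes> (b' \<otimes> t)" using c by (simp add: m_ac)
    also have "\<dots> = (a \<otimes> s') \<otimes> (b \<otimes> t')" using eq by simp
    also have "\<dots> = (a \<otimes> b) \<otimes> (s' \<otimes> t')" using c by (simp add: m_ac)
    finally show "frac (fst (a', s') \<otimes> fst (b', t')) (snd (a', s') \<otimes> snd (b', t')) =
      frac (fst (a, s) \<otimes> fst (b, t)) (snd (a, s) \<otimes> snd (b, t))"
      using c by (simp add: fraction_eq_iff mult_S)
  qed (use assms in auto)
  then show ?thesis by (simp add: localization_def)
qed

lemma add_fraction:
  assumes "a \<in> carrier R" "s \<in> S" "b \<in> carrier R" "t \<in> S"
  shows "frac a s \<oplus>\<^bsub>Loc\<^esub> frac b t = frac (a \<otimes> t \<oplus> b \<otimes> s) (s \<otimes> t)"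
proof -
  have "(\<Union>x \<in> frac a s. \<Union>y \<in> frac b t.
      frac (fst x \<otimes> snd y \<oplus> fst y \<otimes> snd x) (snd x \<otimes> snd y))
    = frac (a \<otimes> t \<oplus> b \<otimes> s) (s \<otimes> t)"
  proof (subst UN_fraction)
    fix a' s' b' t'
    assume h: "a' \<in> carrier R" "s' \<in> S" "b' \<in> carrier R" "t' \<in> S"
      and eq: "a \<otimes> s' = a' \<otimes> s" "b \<otimes> t' = b' \<otimes> t"
    note c = h assms S_closed[OF h(2)] S_closed[OF h(4)] S_closed[OF assms(2)] S_closed[OF assms(4)]
    have "(a' \<otimes> t' \<oplus> b' \<otimes> s') \<otimes> (s \<otimes> t) = (a' \<otimes> s) \<otimes> (t' \<otimes> t) \<oplus> (b' \<otimes> t) \<otimes> (s' \<otimes> s)"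
      using c by (simp add: m_ac l_distr r_distr)
    also have "\<dots> = (a \<otimes> s') \<otimes> (t' \<otimes> t) \<oplus> (b \<otimes> t') \<otimes> (s' \<otimes> s)" using eq by simp
    also have "\<dots> = (a \<otimes> t \<oplus> b \<otimes> s) \<otimes> (s' \<otimes> t')" using c by (simp add: m_ac l_distr r_distr)
    finally show "frac (fst (a', s') \<otimes> snd (b', t') \<oplus> fst (b', t') \<otimes> snd (a', s'))
        (snd (a', s') \<otimes> snd (b', t')) =
      frac (fst (a, s) \<otimes> snd (b, t) \<oplus> fst (b, t) \<otimes> snd (a, s)) (snd (a, s) \<otimes> snd (b, t))"
      using c by (simp add: fraction_eq_iff mult_S)
  qed (use assms in auto)
  then show ?thesis by (simp add: localization_def)
qed

lemma one_localization: "\<one>\<^bsub>Loc\<^esub> = frac \<one> \<one>"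
  by (simp add: localization_def)

lemma zero_localization: "\<zero>\<^bsub>Loc\<^esub> = frac \<zero> \<one>"
  by (simp add: localization_def)

lemma fraction_eq_zero_iff:
  "a \<in> carrier R \<Longrightarrow> s \<in> S \<Longrightarrow> frac a s = \<zero>\<^bsub>Loc\<^esub> \<longleftrightarrow> a = \<zero>"
  by (simp add: zero_localization fraction_eq_iff one_S S_closed)

lemma cring_localization: "cring Loc"
proof (intro cringI abelian_groupI comm_monoidI)
  fix x y assume "x \<in> carrier Loc" "y \<in> carrier Loc"
  then obtain a s b t where h: "a \<in> carrier R" "s \<in> S" "b \<in> carrier R" "t \<in> S"
    "x = frac a s" "y = frac b t" by (metis localization_cases)
  note c = h S_closed[OF h(2)] S_closed[OF h(4)]
  show "x \<oplus>\<^bsub>Loc\<^esub> y \<in> carrier Loc" "x \<otimes>\<^bsub>Loc\<^esub> y \<in> carrier Loc"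
    using c by (auto simp: add_fraction mult_fraction fraction_closed mult_S)
  show "x \<oplus>\<^bsub>Loc\<^esub> y = y \<oplus>\<^bsub>Loc\<^esub> x"
    using c by (simp add: add_fraction m_ac a_ac)
  show "x \<otimes>\<^bsub>Loc\<^esub> y = y \<otimes>\<^bsub>Loc\<^esub> x"
    using c by (simp add: mult_fraction m_ac)
  fix z assume "z \<in> carrier Loc"
  then obtain d r where k: "d \<in> carrier R" "r \<in> S" "z = frac d r" by (metis localization_cases)
  note c = c k S_closed[OF k(2)]
  show "x \<oplus>\<^bsub>Loc\<^esub> y \<oplus>\<^bsub>Loc\<^esub> z = x \<oplus>\<^bsub>Loc\<^esub> (y \<oplus>\<^bsub>Loc\<^esub> z)"
    using c by (simp add: add_fraction mult_S l_distr r_distr m_ac a_ac)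
  show "x \<otimes>\<^bsub>Loc\<^esub> y \<otimes>\<^bsub>Loc\<^esub> z = x \<otimes>\<^bsub>Loc\<^esub> (y \<otimes>\<^bsub>Loc\<^esub> z)"
    using c by (simp add: mult_fraction mult_S m_ac)
  show "(x \<oplus>\<^bsub>Loc\<^esub> y) \<otimes>\<^bsub>Loc\<^esub> z = x \<otimes>\<^bsub>Loc\<^esub> z \<oplus>\<^bsub>Loc\<^esub> y \<otimes>\<^bsub>Loc\<^esub> z"
    using c by (simp add: mult_fraction add_fraction fraction_eq_iff mult_S l_distr r_distr m_ac)
next
  show "\<zero>\<^bsub>Loc\<^esub> \<in> carrier Loc" "\<one>\<^bsub>Loc\<^esub> \<in> carrier Loc"
    by (auto simp: zero_localization one_localization one_S fraction_closed)
next
  fix x assume "x \<in> carrier Loc"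
  then obtain a s where h: "a \<in> carrier R" "s \<in> S" "x = frac a s" by (metis localization_cases)
  note c = h S_closed[OF h(2)]
  show "\<zero>\<^bsub>Loc\<^esub> \<oplus>\<^bsub>Loc\<^esub> x = x"
    using c by (simp add: zero_localization add_fraction one_S)
  show "\<one>\<^bsub>Loc\<^esub> \<otimes>\<^bsub>Loc\<^esub> x = x"
    using c by (simp add: one_localization mult_fraction one_S)
  have "frac (\<ominus> a) s \<oplus>\<^bsub>Loc\<^esub> x = \<zero>\<^bsub>Loc\<^esub>"
    using c by (simp add: add_fraction fraction_eq_zero_iff mult_S l_minus l_neg)
  then show "\<exists>y\<in>carrier Loc. y \<oplus>\<^bsub>Loc\<^esub> x = \<zero>\<^bsub>Loc\<^esub>"
    using c by (metis fraction_closed a_inv_closed)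
qed

lemma domain_localization: "domain Loc"
proof (rule domainI[OF cring_localization])
  show "\<one>\<^bsub>Loc\<^esub> \<noteq> \<zero>\<^bsub>Loc\<^esub>"
    by (simp add: one_localization fraction_eq_zero_iff one_S)
  fix x y assume xy: "x \<otimes>\<^bsub>Loc\<^esub> y = \<zero>\<^bsub>Loc\<^esub>" "x \<in> carrier Loc" "y \<in> carrier Loc"
  then obtain a s b t where h: "a \<in> carrier R" "s \<in> S" "b \<in> carrier R" "t \<in> S"
    "x = frac a s" "y = frac b t" by (metis localization_cases)
  then show "x = \<zero>\<^bsub>Loc\<^esub> \<or> y = \<zero>\<^bsub>Loc\<^esub>"
    using xy by (simp add: mult_fraction fraction_eq_zero_iff mult_S integral_iff)
qed

lemma pow_fraction_one: "a \<in> carrier R \<Longrightarrow> frac a \<one> [^]\<^bsub>Loc\<^esub> (n::nat) = frac (a [^] n) \<one>"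
proof -
  interpret L: cring Loc by (rule cring_localization)
  show "a \<in> carrier R \<Longrightarrow> ?thesis"
    by (induction n) (simp_all add: one_localization mult_fraction one_S)
qed

section \<open>Ideals of the localization and their contractions\<close>

definition contraction :: "('a \<times> 'a) set set \<Rightarrow> 'a set" where
  "contraction J = {a \<in> carrier R. frac a \<one> \<in> J}"

text \<open>Denominators are units of the localization, so membership in an ideal does not see them.
  An ideal is therefore determined by its contraction, and prime chains and finite generation can be
  compared with those in \<open>R\<close>.\<close>

lemma fraction_mem_ideal_iff:
  assumes "ideal J Loc" "a \<in> carrier R" "s \<in> S"
  shows "frac a s \<in> J \<longleftrightarrow> a \<in> contraction J"
proof -
  interpret J: ideal J Loc by fact
  note c = assms S_closed[OF assms(3)] one_S
  have "frac s \<one> \<otimes>\<^bsub>Loc\<^esub> frac a s = frac a \<one>" "frac \<one> s \<otimes>\<^bsub>Loc\<^esub> frac a \<one> = frac a s"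
    using c by (auto simp: mult_fraction fraction_eq_iff mult_S m_ac)
  then show ?thesis
    unfolding contraction_def using c
    by (metis (mono_tags, lifting) J.I_l_closed fraction_closed mem_Collect_eq one_closed)
qed

lemma ideal_contraction:
  assumes "ideal J Loc" shows "ideal (contraction J) R"
proof -
  interpret J: ideal J Loc by fact
  have z: "\<zero> \<in> contraction J"
    using additive_subgroup.zero_closed[OF J.is_additive_subgroup] by (simp add: contraction_def zero_localization)
  have m: "x \<otimes> a \<in> contraction J" if "a \<in> contraction J" "x \<in> carrier R" for a x
    using that J.I_l_closed[of "frac a \<one>" "frac x \<one>"] one_S
    by (simp add: contraction_def fraction_closed mult_fraction)
  have p: "a \<oplus> b \<in> contraction J" if "a \<in> contraction J" "b \<in> contraction J" for a b
    using that additive_subgroup.a_closed[OF J.is_additive_subgroup, of "frac a \<one>" "frac b \<one>"] one_S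
    by (simp add: contraction_def fraction_closed add_fraction)
  have i: "\<ominus> a \<in> contraction J" if "a \<in> contraction J" for a
    using m[OF that, of "\<ominus> \<one>"] that by (simp add: contraction_def l_minus)
  have sub: "contraction J \<subseteq> carrier R" by (auto simp: contraction_def)
  show ?thesis
  proof (rule idealI[OF ring_axioms])
    show "subgroup (contraction J) (add_monoid R)"
      using z p i sub by (intro group.subgroupI a_group) (auto simp: a_inv_def)
  qed (use m sub in \<open>auto simp: m_comm subset_iff\<close>)
qed

lemma primeideal_contraction:
  assumes "primeideal J Loc" shows "primeideal (contraction J) R"
proof -
  interpret J: primeideal J Loc by fact
  show ?thesis
  proof (intro primeidealI ideal_contraction J.is_ideal is_cring)
    have "\<one>\<^bsub>Loc\<^esub> \<notin> J"
      using J.I_notcarr J.one_imp_carrier by auto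
    then show "carrier R \<noteq> contraction J"
      by (auto simp: contraction_def one_localization)
    fix a b assume "a \<in> carrier R" "b \<in> carrier R" "a \<otimes> b \<in> contraction J"
    then show "a \<in> contraction J \<or> b \<in> contraction J"
      using J.I_prime[of "frac a \<one>" "frac b \<one>"] one_S
      by (auto simp: contraction_def fraction_closed mult_fraction)
  qed
qed

lemma contraction_mono_strict:
  assumes "ideal I Loc" "ideal J Loc" "I \<subset> J"
  shows "contraction I \<subset> contraction J"
proof -
  from assms(3) obtain x where x: "x \<in> J" "x \<notin> I" by auto
  interpret J: ideal J Loc by fact
  from x J.Icarr obtain a s where "a \<in> carrier R" "s \<in> S" "x = frac a s"
    by (metis localization_cases)
  with x assms have "a \<in> contraction J" "a \<notin> contraction I"
    by (auto simp: fraction_mem_ideal_iff)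
  moreover have "contraction I \<subseteq> contraction J"
    using assms by (auto simp: contraction_def)
  ultimately show ?thesis by auto
qed

lemma contraction_disjoint:
  assumes "ideal J Loc" "J \<noteq> carrier Loc"
  shows "contraction J \<inter> S = {}"
proof (rule ccontr)
  assume "contraction J \<inter> S \<noteq> {}"
  then obtain s where s: "s \<in> contraction J" "s \<in> S" by auto
  interpret J: ideal J Loc by fact
  have "frac s s \<in> J" using s fraction_mem_ideal_iff[OF assms(1)] S_closed by auto
  moreover have "frac s s = \<one>\<^bsub>Loc\<^esub>"
    using s S_closed one_S by (simp add: one_localization fraction_eq_iff m_ac)
  ultimately show False using J.one_imp_carrier assms(2) by auto
qed

lemma ideal_eq_of_contraction_subset:
  assumes "ideal I Loc" "ideal J Loc" "contraction I \<subseteq> contraction J"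
  shows "I \<subseteq> J"
proof
  fix x assume "x \<in> I"
  interpret I: ideal I Loc by fact
  from \<open>x \<in> I\<close> I.Icarr obtain a s where "a \<in> carrier R" "s \<in> S" "x = frac a s"
    by (metis localization_cases)
  with \<open>x \<in> I\<close> assms show "x \<in> J" by (auto simp: fraction_mem_ideal_iff)
qed

text \<open>Finitely many generators of the contraction of \<open>J\<close>, viewed as fractions
  with denominator one, generate \<open>J\<close>, because \<open>J\<close> is determined by its
  contraction.\<close>

lemma noetherian_localization:
  assumes "noetherian_ring R"
  shows "noetherian_ring Loc"
proof -
  interpret L: cring Loc by (rule cring_localization)
  interpret N: noetherian_ring R by fact
  show ?thesis
  proof (rule L.noetherian_ringI)
    fix J assume J: "ideal J Loc"
    from N.finetely_gen[OF ideal_contraction[OF J]] obtain G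
      where G: "G \<subseteq> carrier R" "finite G" "contraction J = Idl G" by auto
    define H where "H = (\<lambda>a. frac a \<one>) ` G"
    have Hc: "H \<subseteq> carrier Loc" using G one_S by (auto simp: H_def fraction_closed)
    have GJ: "G \<subseteq> contraction J" using G genideal_self by auto
    have "Idl\<^bsub>Loc\<^esub> H \<subseteq> J"
      using GJ by (intro L.genideal_minimal[OF J]) (auto simp: H_def contraction_def)
    moreover have "J \<subseteq> Idl\<^bsub>Loc\<^esub> H"
    proof (rule ideal_eq_of_contraction_subset[OF J L.genideal_ideal[OF Hc]])
      have "G \<subseteq> contraction (Idl\<^bsub>Loc\<^esub> H)"
        using L.genideal_self[OF Hc] G by (auto simp: H_def contraction_def)
      then show "contraction J \<subseteq> contraction (Idl\<^bsub>Loc\<^esub> H)"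
        unfolding G(3) by (intro genideal_minimal ideal_contraction L.genideal_ideal Hc)
    qed
    ultimately show "\<exists>A\<subseteq>carrier Loc. finite A \<and> J = Idl\<^bsub>Loc\<^esub> A"
      using Hc G by (intro exI[of _ H]) (auto simp: H_def)
  qed
qed

end

lemma (in primeideal) domain_fractions_compl:
  assumes "domain R" shows "domain_fractions R (carrier R - I)"
proof -
  interpret D: domain R by fact
  show ?thesis
    by unfold_locales (use I_notcarr I_prime one_imp_carrier in auto)
qed

context domain_fractions begin

text \<open>A proper ideal contracts to an ideal disjoint from \<open>S\<close>, that is, inside
  \<open>m\<close>; hence it lies in \<open>M\<close>. The second conclusion yields maximality here
  and uniqueness of the maximal ideal later.\<close>

lemma local_maximal_ideal:
  assumes m: "ideal m R" and S: "S = carrier R - m"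
  defines "M \<equiv> {frac a s | a s. a \<in> m \<and> s \<in> S}"
  shows "maximalideal M Loc" "\<And>J. ideal J Loc \<Longrightarrow> J \<noteq> carrier Loc \<Longrightarrow> J \<subseteq> M"
proof -
  interpret L: cring Loc by (rule cring_localization)
  interpret m: ideal m R by fact
  have one: "\<one> \<notin> m" using one_S S by auto
  \<comment> \<open>Independence of the representative: if \<open>a\<close> is outside
    \<open>m\<close>, then so is its product with any denominator, since the complement
    \<open>S\<close> is closed under multiplication.\<close>
  have mem: "frac a s \<in> M \<longleftrightarrow> a \<in> m" if h: "a \<in> carrier R" "s \<in> S" for a s
  proof
    assume "frac a s \<in> M"
    then obtain b t where k: "b \<in> m" "t \<in> S" "frac a s = frac b t" by (auto simp: M_def)
    then have "a \<otimes> t \<in> m"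
      using h S_closed m.I_r_closed[OF k(1), of s] m.Icarr by (simp add: fraction_eq_iff)
    then show "a \<in> m" using h k(2) mult_S[of a t] unfolding S by auto
  qed (use h in \<open>auto simp: M_def\<close>)
  have Mc: "M \<subseteq> carrier Loc" by (auto simp: M_def fraction_closed m.Icarr)
  have M: "ideal M Loc"
  proof -
    have mult: "x \<otimes>\<^bsub>Loc\<^esub> a \<in> M" if ax: "a \<in> M" "x \<in> carrier Loc" for a x
    proof -
      obtain b t where b: "b \<in> m" "t \<in> S" "a = frac b t" using ax(1) by (auto simp: M_def)
      obtain c r where c: "c \<in> carrier R" "r \<in> S" "x = frac c r"
        using ax(2) by (metis localization_cases)
      show ?thesis using b c m.Icarr[OF b(1)] m.I_l_closed[OF b(1) c(1)]
        by (simp add: mult_fraction mult_S mem)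
    qed
    have add: "a \<oplus>\<^bsub>Loc\<^esub> b \<in> M" if ab: "a \<in> M" "b \<in> M" for a b
    proof -
      obtain x t y r where b: "x \<in> m" "t \<in> S" "a = frac x t" "y \<in> m" "r \<in> S" "b = frac y r"
        using ab by (auto simp: M_def)
      then show ?thesis using m.Icarr[OF b(1)] m.Icarr[OF b(4)] S_closed
          m.I_r_closed[OF b(1), of r] m.I_r_closed[OF b(4), of t]
        by (simp add: add_fraction mult_S mem)
    qed
    have neg: "\<ominus>\<^bsub>Loc\<^esub> a \<in> M" if "a \<in> M" for a
      using mult[OF that, of "\<ominus>\<^bsub>Loc\<^esub> \<one>\<^bsub>Loc\<^esub>"] that Mc by (auto simp: L.l_minus)
    have "\<zero>\<^bsub>Loc\<^esub> \<in> M" by (simp add: zero_localization mem one_S)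
    then have "subgroup M (add_monoid Loc)"
      using Mc add neg by (intro group.subgroupI L.a_group) (auto simp: a_inv_def)
    then show ?thesis
      by (rule idealI[OF L.ring_axioms]) (use mult Mc in \<open>auto simp: L.m_comm subset_iff\<close>)
  qed
  show sub: "J \<subseteq> M" if J: "ideal J Loc" "J \<noteq> carrier Loc" for J
  proof
    fix x assume x: "x \<in> J"
    interpret J: ideal J Loc by fact
    obtain a s where a: "a \<in> carrier R" "s \<in> S" "x = frac a s"
      using J.Icarr[OF x] by (metis localization_cases)
    then have "a \<in> contraction J" using x J(1) by (simp add: fraction_mem_ideal_iff)
    then have "a \<in> m" using contraction_disjoint[OF J] a S by auto
    then show "x \<in> M" using a by (auto simp: M_def)
  qed
  have "\<one>\<^bsub>Loc\<^esub> \<notin> M" using one by (simp add: one_localization mem one_S)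
  then have "carrier Loc \<noteq> M" by auto
  then show "maximalideal M Loc"
    using M sub by (intro maximalidealI) auto
qed

end

section \<open>Semigroup rings\<close>

lemma poly_mapping_sum_single:
  "f = (\<Sum>x\<in>Poly_Mapping.keys f. Poly_Mapping.single x (Poly_Mapping.lookup f x))"
  by (rule poly_mapping_eqI)
    (simp add: lookup_sum lookup_single when_def in_keys_iff sum.delta)

lemma lookup_mult_eq_sum:
  "Poly_Mapping.lookup (f * g) k =
     (\<Sum>x\<in>Poly_Mapping.keys f. \<Sum>y\<in>Poly_Mapping.keys g.
        (Poly_Mapping.lookup f x * Poly_Mapping.lookup g y when x + y = k))"
proof -
  have "f * g = (\<Sum>x\<in>Poly_Mapping.keys f. Poly_Mapping.single x (Poly_Mapping.lookup f x)) *
      (\<Sum>y\<in>Poly_Mapping.keys g. Poly_Mapping.single y (Poly_Mapping.lookup g y))"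
    by (simp flip: poly_mapping_sum_single)
  also have "\<dots> = (\<Sum>x\<in>Poly_Mapping.keys f. \<Sum>y\<in>Poly_Mapping.keys g.
     Poly_Mapping.single (x + y) (Poly_Mapping.lookup f x * Poly_Mapping.lookup g y))"
    by (simp add: sum_product mult_single)
  finally show ?thesis
    by (simp add: lookup_sum lookup_single)
qed

text \<open>Only one summand of the convolution contributes, so nothing can cancel. This serves both
  for leading exponents in the lexicographic order and, in the division argument, for exponents of
  maximal coordinate sum.\<close>

lemma lookup_mult_unique:
  assumes "\<And>x y. \<lbrakk>x \<in> Poly_Mapping.keys f; y \<in> Poly_Mapping.keys g; x + y = a + b\<rbrakk> \<Longrightarrow> x = a \<and> y = b"
  shows "Poly_Mapping.lookup (f * g) (a + b) = Poly_Mapping.lookup f a * Poly_Mapping.lookup g b"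
proof -
  have "Poly_Mapping.lookup (f * g) (a + b) =
     (\<Sum>x\<in>Poly_Mapping.keys f. \<Sum>y\<in>Poly_Mapping.keys g.
        (if x = a then if y = b then Poly_Mapping.lookup f a * Poly_Mapping.lookup g b else 0 else 0))"
    unfolding lookup_mult_eq_sum using assms by (intro sum.cong refl) (auto simp: when_def)
  also have "\<dots> = (\<Sum>x\<in>Poly_Mapping.keys f.
     (if x = a then \<Sum>y\<in>Poly_Mapping.keys g.
       (if y = b then Poly_Mapping.lookup f a * Poly_Mapping.lookup g b else 0) else 0))"
    by (intro sum.cong refl) auto
  also have "\<dots> = Poly_Mapping.lookup f a * Poly_Mapping.lookup g b"
    by (simp add: in_keys_iff)
  finally show ?thesis .
qed

text \<open>A monomial order: total, compatible with addition and well-founded, so that reduction by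
  leading terms terminates.\<close>

definition lex_less :: "nat \<times> nat \<Rightarrow> nat \<times> nat \<Rightarrow> bool" where
  "lex_less x y \<longleftrightarrow> fst x < fst y \<or> fst x = fst y \<and> snd x < snd y"

lemma wf_lex_less: "wf {(x, y). lex_less x y}"
proof -
  have "{(x, y). lex_less x y} = less_than <*lex*> less_than"
    by (auto simp: lex_less_def)
  then show ?thesis by (simp add: wf_lex_prod)
qed

lemma lex_less_trans: "lex_less x y \<Longrightarrow> lex_less y z \<Longrightarrow> lex_less x z"
  by (auto simp: lex_less_def)

lemma lex_less_linear: "lex_less x y \<or> x = y \<or> lex_less y x"
  by (auto simp: lex_less_def prod_eq_iff)

lemma lex_less_add_left [simp]: "lex_less (z + x) (z + y) \<longleftrightarrow> lex_less x y"
  by (auto simp: lex_less_def)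

lemma lex_less_add_eq:
  "x + y = a + b \<Longrightarrow> x = a \<or> lex_less x a \<Longrightarrow> y = b \<or> lex_less y b \<Longrightarrow> x = a \<and> y = b"
  by (auto simp: lex_less_def prod_eq_iff)

definition leading_key :: "(nat \<times> nat \<Rightarrow>\<^sub>0 'b::zero) \<Rightarrow> nat \<times> nat \<Rightarrow> bool" where
  "leading_key f a \<longleftrightarrow>
     a \<in> Poly_Mapping.keys f \<and> (\<forall>x\<in>Poly_Mapping.keys f. x = a \<or> lex_less x a)"

lemma leading_key_exists:
  assumes "f \<noteq> 0" shows "\<exists>a. leading_key f a"
proof -
  have "\<exists>a\<in>K. \<forall>x\<in>K. x = a \<or> lex_less x a" if "finite K" "K \<noteq> {}" for K
    using that
  proof (induction rule: finite_ne_induct)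
    case (insert b K)
    from insert.IH obtain a where "a \<in> K" "\<forall>x\<in>K. x = a \<or> lex_less x a" ..
    then show ?case using lex_less_linear[of a b] lex_less_trans by (metis insert_iff)
  qed auto
  from this[of "Poly_Mapping.keys f"] assms show ?thesis
    by (auto simp: leading_key_def Bex_def)
qed

lemma lookup_mult_leading:
  assumes "leading_key f a" "leading_key g b"
  shows "Poly_Mapping.lookup (f * g) (a + b) = Poly_Mapping.lookup f a * Poly_Mapping.lookup g b"
  using assms unfolding leading_key_def by (intro lookup_mult_unique lex_less_add_eq) auto

text \<open>The product of two leading coefficients is a nonzero coefficient of the product.\<close>

lemma poly_mapping_mult_eq_0_iff:
  fixes f g :: "(nat \<times> nat) \<Rightarrow>\<^sub>0 'k::field"
  shows "f * g = 0 \<longleftrightarrow> f = 0 \<or> g = 0"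
proof
  assume fg: "f * g = 0"
  show "f = 0 \<or> g = 0"
  proof (rule ccontr)
    assume "\<not> (f = 0 \<or> g = 0)"
    then obtain a b where ab: "leading_key f a" "leading_key g b"
      using leading_key_exists by blast
    then have "Poly_Mapping.lookup (f * g) (a + b) \<noteq> 0"
      unfolding lookup_mult_leading[OF ab] by (auto simp: leading_key_def in_keys_iff)
    with fg show False by simp
  qed
qed auto

lemma poly_mapping_power_eq_0_iff:
  fixes f :: "(nat \<times> nat) \<Rightarrow>\<^sub>0 'k::field"
  shows "f ^ n = 0 \<longleftrightarrow> f = 0 \<and> n > 0"
  by (induction n) (auto simp: poly_mapping_mult_eq_0_iff)

section \<open>Polynomials with exponents in a prescribed set\<close>

definition supported_on :: "'a set \<Rightarrow> ('a \<Rightarrow>\<^sub>0 'b::zero) set" where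
  "supported_on S = {f. Poly_Mapping.keys f \<subseteq> S}"

lemma supported_on_zero [simp]: "0 \<in> supported_on S"
  by (simp add: supported_on_def)

lemma supported_on_add: "f \<in> supported_on S \<Longrightarrow> g \<in> supported_on S \<Longrightarrow> f + g \<in> supported_on S"
  using Poly_Mapping.keys_add[of f g] by (auto simp: supported_on_def)

lemma supported_on_uminus: "f \<in> supported_on S \<Longrightarrow> - f \<in> supported_on S"
  for f :: "_ \<Rightarrow>\<^sub>0 _::ab_group_add"
  by (auto simp: supported_on_def in_keys_iff)

lemma supported_on_diff: "f \<in> supported_on S \<Longrightarrow> g \<in> supported_on S \<Longrightarrow> f - g \<in> supported_on S"
  for f :: "_ \<Rightarrow>\<^sub>0 _::ab_group_add"
  using supported_on_add[of f S "- g"] by (simp add: supported_on_uminus)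

lemma supported_on_sum:
  "(\<And>i. i \<in> I \<Longrightarrow> f i \<in> supported_on S) \<Longrightarrow> sum f I \<in> supported_on S"
  by (induction I rule: infinite_finite_induct) (auto intro: supported_on_add)

lemma supported_on_single [simp]: "Poly_Mapping.single x c \<in> supported_on S \<longleftrightarrow> c = 0 \<or> x \<in> S"
  by (simp add: supported_on_def)

lemma supported_on_mult:
  assumes "f \<in> supported_on S" "g \<in> supported_on T" "\<And>x y. x \<in> S \<Longrightarrow> y \<in> T \<Longrightarrow> x + y \<in> U"
  shows "f * g \<in> supported_on U"
  using Poly_Mapping.keys_mult[of f g] assms unfolding supported_on_def by blast

lemma supported_on_mult_submonoid:
  "add_submonoid S \<Longrightarrow> f \<in> supported_on S \<Longrightarrow> g \<in> supported_on S \<Longrightarrow> f * g \<in> supported_on S"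
  by (rule supported_on_mult) (auto simp: add_submonoid_def)

lemma supported_on_one: "add_submonoid S \<Longrightarrow> 1 \<in> supported_on S"
  by (auto simp: supported_on_def add_submonoid_def)

lemma supported_on_power:
  "add_submonoid S \<Longrightarrow> f \<in> supported_on S \<Longrightarrow> f ^ n \<in> supported_on S"
  by (induction n) (auto intro: supported_on_one supported_on_mult_submonoid)

lemma supported_on_induct:
  fixes f :: "'a \<Rightarrow>\<^sub>0 'b::comm_monoid_add"
  assumes "f \<in> supported_on S" "Q 0" "\<And>f g. Q f \<Longrightarrow> Q g \<Longrightarrow> Q (f + g)"
    "\<And>x c. x \<in> S \<Longrightarrow> Q (Poly_Mapping.single x c)"
  shows "Q f"
proof -
  have "Q (\<Sum>x\<in>K. Poly_Mapping.single x (Poly_Mapping.lookup f x))" if "K \<subseteq> S" for K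
    using that by (induction K rule: infinite_finite_induct) (auto intro: assms)
  from this[of "Poly_Mapping.keys f"] assms(1) show ?thesis
    by (simp add: supported_on_def flip: poly_mapping_sum_single)
qed

lemma a_inv_ring_of_type_algebra:
  "\<ominus>\<^bsub>ring_of_type_algebra\<^esub> x = - (x :: 'a::comm_ring_1)"
proof -
  interpret R: cring "ring_of_type_algebra :: 'a ring" ..
  have "x \<oplus>\<^bsub>ring_of_type_algebra\<^esub> (- x) = \<zero>\<^bsub>ring_of_type_algebra\<^esub>"
    by (simp add: ring_of_type_algebra_def)
  then show ?thesis
    by (intro R.minus_equality) (simp_all add: ring_of_type_algebra_def)
qed

lemma semigroup_ring_sel [simp]:
  "x \<otimes>\<^bsub>semigroup_ring S\<^esub> y = x * y" "x \<oplus>\<^bsub>semigroup_ring S\<^esub> y = x + y"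
  "\<one>\<^bsub>semigroup_ring S\<^esub> = 1" "\<zero>\<^bsub>semigroup_ring S\<^esub> = 0"
  by (simp_all add: semigroup_ring_def ring_of_type_algebra_def)

text \<open>The ring operations preserve support in the submonoid \<open>S\<close>; conversely every
  term is a constant times a monomial, both of them generators. From here on, membership in the
  semigroup ring is a statement about exponents only.\<close>

lemma carrier_semigroup_ring:
  assumes S: "add_submonoid S"
  shows "carrier (semigroup_ring S :: ((nat \<times> nat) \<Rightarrow>\<^sub>0 'k::field) ring) = supported_on S"
proof -
  define K :: "((nat \<times> nat) \<Rightarrow>\<^sub>0 'k) ring" where "K = ring_of_type_algebra"
  define H :: "((nat \<times> nat) \<Rightarrow>\<^sub>0 'k) set"
    where "H = Set.range (Poly_Mapping.single 0) \<union> (\<lambda>s. Poly_Mapping.single s 1) ` S"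
  have K: "x \<otimes>\<^bsub>K\<^esub> y = x * y" "x \<oplus>\<^bsub>K\<^esub> y = x + y" "\<one>\<^bsub>K\<^esub> = 1" "\<ominus>\<^bsub>K\<^esub> x = - x" for x y
    by (simp_all add: K_def a_inv_ring_of_type_algebra, simp_all add: ring_of_type_algebra_def)
  have zero: "0 \<in> S" using S by (simp add: add_submonoid_def)
  have "f \<in> supported_on S" if "f \<in> generate_ring K H" for f
    using that
    by induction (auto simp: K H_def supported_on_one[OF S] zero
        intro: supported_on_uminus supported_on_add supported_on_mult_submonoid[OF S])
  moreover have "f \<in> generate_ring K H" if "f \<in> supported_on S" for f
    using that
  proof (rule supported_on_induct)
    show "0 \<in> generate_ring K H"
      by (rule generate_ring.incl) (auto simp: H_def intro!: image_eqI[of _ _ 0])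
    show "f + g \<in> generate_ring K H" if "f \<in> generate_ring K H" "g \<in> generate_ring K H" for f g
      using generate_ring.eng_add[OF that] by (simp add: K)
    fix x and c :: 'k assume "x \<in> S"
    then have "Poly_Mapping.single 0 c \<in> generate_ring K H" "Poly_Mapping.single x 1 \<in> generate_ring K H"
      by (auto simp: H_def intro!: generate_ring.incl)
    from generate_ring.eng_mult[OF this] show "Poly_Mapping.single x c \<in> generate_ring K H"
      by (simp add: K mult_single)
  qed
  ultimately show ?thesis
    by (auto simp: semigroup_ring_def K_def H_def)
qed

lemma domain_semigroup_ring:
  assumes S: "add_submonoid S"
  shows "domain (semigroup_ring S :: ((nat \<times> nat) \<Rightarrow>\<^sub>0 'k::field) ring)"
proof (rule domainI)
  show "cring (semigroup_ring S :: ((nat \<times> nat) \<Rightarrow>\<^sub>0 'k) ring)"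
  proof (intro cringI abelian_groupI comm_monoidI)
    fix x :: "(nat \<times> nat) \<Rightarrow>\<^sub>0 'k" assume "x \<in> carrier (semigroup_ring S)"
    then show "\<exists>y\<in>carrier (semigroup_ring S). y \<oplus>\<^bsub>semigroup_ring S\<^esub> x = \<zero>\<^bsub>semigroup_ring S\<^esub>"
      by (intro bexI[of _ "- x"]) (auto simp: carrier_semigroup_ring[OF S] supported_on_uminus)
  qed (auto simp: carrier_semigroup_ring[OF S] algebra_simps
      supported_on_one[OF S] supported_on_mult_submonoid[OF S] supported_on_add)
qed (auto simp: poly_mapping_mult_eq_0_iff)

text \<open>Dickson's condition for divisibility inside the semigroup ring: the quotient exponent
  \<open>s\<close> must again lie in \<open>S\<close>, so componentwise comparison in the plane
  would be too weak.\<close>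

definition divisor_finite :: "(nat \<times> nat) set \<Rightarrow> bool" where
  "divisor_finite S \<longleftrightarrow> (\<forall>M\<subseteq>S. \<exists>G\<subseteq>M. finite G \<and> (\<forall>x\<in>M. \<exists>g\<in>G. \<exists>s\<in>S. x = s + g))"

text \<open>The Groebner basis form of Hilbert's basis theorem: choose finitely many elements of the
  ideal whose leading exponents divide the leading exponents of all its elements. Subtracting
  monomial multiples of them lowers the leading exponent, and well-founded induction
  finishes.\<close>

lemma noetherian_semigroup_ring:
  assumes S: "add_submonoid S" and fin: "divisor_finite S"
  shows "noetherian_ring (semigroup_ring S :: ((nat \<times> nat) \<Rightarrow>\<^sub>0 'k::field) ring)"
proof -
  let ?R = "semigroup_ring S :: ((nat \<times> nat) \<Rightarrow>\<^sub>0 'k) ring"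
  interpret domain ?R by (rule domain_semigroup_ring[OF S])
  have car: "carrier ?R = supported_on S" by (rule carrier_semigroup_ring[OF S])
  show ?thesis
  proof (rule noetherian_ringI)
    fix I assume I: "ideal I ?R"
    interpret I: ideal I ?R by fact
    define M where "M = {a. \<exists>f\<in>I. leading_key f a}"
    have I_sub: "f \<in> supported_on S" if "f \<in> I" for f
      using I.Icarr[OF that] car by simp
    have "M \<subseteq> S" using I_sub by (auto simp: M_def leading_key_def supported_on_def)
    then obtain G where G: "G \<subseteq> M" "finite G" "\<And>x. x \<in> M \<Longrightarrow> \<exists>g\<in>G. \<exists>s\<in>S. x = s + g"
      using fin unfolding divisor_finite_def by meson
    have "\<forall>g\<in>G. \<exists>f\<in>I. leading_key f g" using G(1) by (auto simp: M_def)
    then obtain h where h: "\<And>g. g \<in> G \<Longrightarrow> h g \<in> I \<and> leading_key (h g) g" by metis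
    define A where "A = h ` G"
    have AI: "A \<subseteq> I" using h by (auto simp: A_def)
    have A: "A \<subseteq> carrier ?R" using AI I.Icarr by auto
    interpret J: ideal "Idl\<^bsub>?R\<^esub> A" ?R by (rule genideal_ideal[OF A])
    have J0: "0 \<in> Idl\<^bsub>?R\<^esub> A" using additive_subgroup.zero_closed[OF J.is_additive_subgroup] by simp
    have *: "\<forall>f\<in>I. leading_key f a \<longrightarrow> f \<in> Idl\<^bsub>?R\<^esub> A" for a
    proof (induction a rule: wf_induct_rule[OF wf_lex_less, case_names less])
      case (less a)
      show ?case
      proof (intro ballI impI)
        fix f assume f: "f \<in> I" "leading_key f a"
        then have "a \<in> M" by (auto simp: M_def)
        then obtain g s where gs: "g \<in> G" "s \<in> S" "a = s + g" using G(3) by blast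
        \<comment> \<open>The coefficient that makes the leading terms of \<open>f\<close> and of
          the shifted \<open>h g\<close> cancel.\<close>
        define c where "c = Poly_Mapping.lookup f a / Poly_Mapping.lookup (h g) g"
        define m where "m = Poly_Mapping.single s c"
        have hg: "h g \<in> I" "leading_key (h g) g" using h gs by auto
        have hgJ: "h g \<in> Idl\<^bsub>?R\<^esub> A" using genideal_self[OF A] gs by (auto simp: A_def)
        have mS: "m \<in> carrier ?R" using gs by (simp add: m_def car)
        have mI: "m * h g \<in> I" using I.I_l_closed[OF hg(1) mS] by simp
        have mJ: "m * h g \<in> Idl\<^bsub>?R\<^esub> A" using J.I_l_closed[OF hgJ mS] by simp
        define f' where "f' = f + - 1 * (m * h g)"
        have mone: "- 1 \<in> carrier ?R" by (simp add: car supported_on_uminus supported_on_one[OF S])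
        have f'I: "f' \<in> I"
          using additive_subgroup.a_closed[OF I.is_additive_subgroup f(1) I.I_l_closed[OF mI mone]] by (simp add: f'_def)
        have "c \<noteq> 0" using hg(2) f(2) by (auto simp: c_def leading_key_def in_keys_iff)
        then have "leading_key m s" by (auto simp: leading_key_def m_def)
        then have "Poly_Mapping.lookup (m * h g) (s + g) = c * Poly_Mapping.lookup (h g) g"
          using hg(2) by (simp add: lookup_mult_leading) (simp add: m_def)
        also have "\<dots> = Poly_Mapping.lookup f a"
          using hg(2) by (auto simp: c_def leading_key_def in_keys_iff)
        finally have "Poly_Mapping.lookup f' a = 0"
          by (simp add: f'_def lookup_minus gs)
        moreover have "x = a \<or> lex_less x a" if "x \<in> Poly_Mapping.keys f'" for x
        proof -
          have "x \<in> Poly_Mapping.keys f \<or> x \<in> Poly_Mapping.keys (m * h g)"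
            using that by (auto simp: f'_def in_keys_iff lookup_minus)
          then show ?thesis
          proof
            assume "x \<in> Poly_Mapping.keys (m * h g)"
            then obtain y where "y \<in> Poly_Mapping.keys (h g)" "x = s + y"
              using Poly_Mapping.keys_mult[of m "h g"] by (auto simp: m_def split: if_splits)
            then show ?thesis using hg(2) by (auto simp: leading_key_def gs)
          qed (use f in \<open>auto simp: leading_key_def\<close>)
        qed
        ultimately have lt: "lex_less x a" if "x \<in> Poly_Mapping.keys f'" for x
          using that unfolding in_keys_iff by metis
        have "f' \<in> Idl\<^bsub>?R\<^esub> A"
        proof (cases "f' = 0")
          case False
          then obtain b where "leading_key f' b" using leading_key_exists by blast
          moreover from this lt have "lex_less b a" by (auto simp: leading_key_def)
          ultimately show ?thesis using less f'I by blast
        qed (simp add: J0)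
        from additive_subgroup.a_closed[OF J.is_additive_subgroup this mJ] show "f \<in> Idl\<^bsub>?R\<^esub> A"
          by (simp add: f'_def)
      qed
    qed
    have "I \<subseteq> Idl\<^bsub>?R\<^esub> A"
    proof
      fix f assume "f \<in> I"
      show "f \<in> Idl\<^bsub>?R\<^esub> A"
      proof (cases "f = 0")
        case False
        then obtain b where "leading_key f b" using leading_key_exists by blast
        with * \<open>f \<in> I\<close> show ?thesis by blast
      qed (simp add: J0)
    qed
    moreover have "Idl\<^bsub>?R\<^esub> A \<subseteq> I" by (rule genideal_minimal[OF I AI])
    ultimately show "\<exists>A\<subseteq>carrier ?R. finite A \<and> I = Idl\<^bsub>?R\<^esub> A"
      using A G(2) by (intro exI[of _ A]) (auto simp: A_def)
  qed
qed

section \<open>Chains of prime ideals\<close>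

text \<open>Gaussian elimination by induction on the equations: there are more unknowns
  \<open>I\<close> than equations \<open>K\<close>, and each equation that is not identically zero
  is used to eliminate one unknown.\<close>

lemma exists_nontrivial_linear_relation:
  fixes M :: "'i \<Rightarrow> 'j \<Rightarrow> 'k::field"
  assumes "finite K" "finite I" "card K < card I"
  shows "\<exists>c. (\<exists>i\<in>I. c i \<noteq> 0) \<and> (\<forall>k\<in>K. (\<Sum>i\<in>I. c i * M i k) = 0)"
  using assms
proof (induction K arbitrary: I M rule: finite_induct)
  case empty
  then have "I \<noteq> {}" by auto
  then show ?case by (intro exI[of _ "\<lambda>_. 1"]) auto
next
  case (insert k K)
  show ?case
  proof (cases "\<forall>i\<in>I. M i k = 0")
    case True
    have "finite I" "card K < card I" using insert by auto
    from insert.IH[OF this, of M] obtain c where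
      "\<exists>i\<in>I. c i \<noteq> 0" "\<forall>k\<in>K. (\<Sum>i\<in>I. c i * M i k) = 0" by blast
    with True show ?thesis by (intro exI[of _ c]) auto
  next
    case False
    then obtain j where j: "j \<in> I" "M j k \<noteq> 0" by auto
    define M' where "M' i l = M i l - M i k / M j k * M j l" for i l
    have "finite (I - {j})" "card K < card (I - {j})" using insert j by auto
    from insert.IH[OF this, of M'] obtain c where
      c: "\<exists>i\<in>I - {j}. c i \<noteq> 0" "\<And>l. l \<in> K \<Longrightarrow> (\<Sum>i\<in>I - {j}. c i * M' i l) = 0" by blast
    \<comment> \<open>The eliminated unknown \<open>j\<close> gets the value that solves equation
      \<open>k\<close>; with it the original system takes the values of the reduced one.\<close>
    define d where "d = c(j := - (\<Sum>i\<in>I - {j}. c i * M i k) / M j k)"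
    have sum_d: "(\<Sum>i\<in>I. d i * M i l) = (\<Sum>i\<in>I - {j}. c i * M' i l)" for l
    proof -
      have "(\<Sum>i\<in>I. d i * M i l) = d j * M j l + (\<Sum>i\<in>I - {j}. d i * M i l)"
        using j insert.prems by (simp add: sum.remove)
      also have "(\<Sum>i\<in>I - {j}. d i * M i l) = (\<Sum>i\<in>I - {j}. c i * M i l)"
        by (intro sum.cong) (auto simp: d_def)
      also have "d j * M j l = - (\<Sum>i\<in>I - {j}. c i * (M i k / M j k * M j l))"
        by (simp add: d_def sum_distrib_right sum_divide_distrib mult.assoc)
      finally show ?thesis by (simp add: M'_def right_diff_distrib sum_subtractf)
    qed
    have "(\<Sum>i\<in>I. d i * M i l) = 0" if "l \<in> insert k K" for l
      using that c(2) j by (auto simp: sum_d M'_def)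
    moreover have "\<exists>i\<in>I. d i \<noteq> 0" using c(1) by (auto simp: d_def)
    ultimately show ?thesis by blast
  qed
qed

text \<open>A count: there are \<open>N^3\<close> products of powers with exponents below
  \<open>N\<close>, but their exponents lie in a square with about \<open>(3 * D * N)^2\<close>
  lattice points. The nested form of the relation, in \<open>x\<close> over \<open>y\<close> over
  \<open>z\<close>, is the order in which it is peeled off along a chain of primes.\<close>

lemma algebraically_dependent_three:
  fixes x y z :: "(nat \<times> nat) \<Rightarrow>\<^sub>0 'k::field"
  obtains N C where "\<exists>i<N. \<exists>j<N. \<exists>k<N. C i j k \<noteq> 0"
    "(\<Sum>i<N. (\<Sum>j<N. (\<Sum>k<N. Poly_Mapping.single 0 (C i j k) * z ^ k) * y ^ j) * x ^ i) = 0"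
proof -
  define box where "box n = {..n} \<times> {..n}" for n :: nat
  have box_mono: "supported_on (box m) \<subseteq> supported_on (box n)" if "m \<le> n" for m n
    using that by (auto simp: supported_on_def box_def)
  have "\<exists>n. f \<in> supported_on (box n)" for f :: "(nat \<times> nat) \<Rightarrow>\<^sub>0 'k"
  proof
    show "f \<in> supported_on (box (\<Sum>a\<in>Poly_Mapping.keys f. fst a + snd a))"
    proof -
      have "fst a + snd a \<le> (\<Sum>a\<in>Poly_Mapping.keys f. fst a + snd a)" if "a \<in> Poly_Mapping.keys f" for a
        using that by (intro member_le_sum) auto
      then show ?thesis by (fastforce simp: supported_on_def box_def)
    qed
  qed
  then obtain a b c where "x \<in> supported_on (box a)" "y \<in> supported_on (box b)" "z \<in> supported_on (box c)"
    by meson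
  then obtain D where D: "x \<in> supported_on (box D)" "y \<in> supported_on (box D)" "z \<in> supported_on (box D)"
    using box_mono[of a "a + b + c"] box_mono[of b "a + b + c"] box_mono[of c "a + b + c"] by auto
  have box_mult: "f * g \<in> supported_on (box (m + n))"
    if "f \<in> supported_on (box m)" "g \<in> supported_on (box n)" for f g :: "(nat \<times> nat) \<Rightarrow>\<^sub>0 'k" and m n
    using that by (rule supported_on_mult) (auto simp: box_def)
  have box_pow: "f ^ n \<in> supported_on (box (D * n))"
    if "f \<in> supported_on (box D)" for f :: "(nat \<times> nat) \<Rightarrow>\<^sub>0 'k" and n
  proof (induction n)
    case 0
    show ?case by (simp add: supported_on_def box_def zero_prod_def)
  next
    case (Suc n)
    from box_mult[OF that Suc] show ?case by simp
  qed
  \<comment> \<open>One more than the square of \<open>3 * D + 1\<close>, so that the bound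
    \<open>((3 * D + 1) * N)^2\<close> on the number of lattice points stays below
    \<open>N^3\<close>.\<close>
  define N where "N = Suc ((3 * D + 1) ^ 2)"
  define I where "I = {..<N} \<times> {..<N} \<times> {..<N}"
  define v where "v = (\<lambda>(i, j, k). z ^ k * y ^ j * x ^ i)"
  have v: "v p \<in> supported_on (box (3 * D * N))" if "p \<in> I" for p
  proof -
    obtain i j k where p: "p = (i, j, k)" by (metis prod_cases3)
    have "v p \<in> supported_on (box (D * k + D * j + D * i))"
      unfolding v_def p by (auto intro!: box_mult box_pow D)
    moreover have "D * k + D * j + D * i \<le> D * N + D * N + D * N"
      using that by (intro add_mono mult_le_mono) (auto simp: p I_def)
    ultimately show ?thesis using box_mono[of "D * k + D * j + D * i" "3 * D * N"] by auto
  qed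
  have "card (box (3 * D * N)) = (3 * D * N + 1) ^ 2"
    by (simp add: box_def power2_eq_square)
  also have "\<dots> \<le> ((3 * D + 1) * N) ^ 2"
    by (intro power_mono) (auto simp: N_def algebra_simps)
  also have "\<dots> = (3 * D + 1) ^ 2 * N ^ 2"
    by (rule power_mult_distrib)
  also have "\<dots> < N * N ^ 2"
    by (rule mult_strict_right_mono) (simp_all add: N_def)
  also have "\<dots> = card I"
    by (simp add: I_def power2_eq_square)
  finally have "\<exists>c. (\<exists>p\<in>I. c p \<noteq> 0) \<and>
      (\<forall>q\<in>box (3 * D * N). (\<Sum>p\<in>I. c p * Poly_Mapping.lookup (v p) q) = 0)"
    by (intro exists_nontrivial_linear_relation) (auto simp: box_def I_def)
  then obtain c where c: "\<exists>p\<in>I. c p \<noteq> 0"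
    "\<And>q. q \<in> box (3 * D * N) \<Longrightarrow> (\<Sum>p\<in>I. c p * Poly_Mapping.lookup (v p) q) = 0" by auto
  have *: "(\<Sum>p\<in>I. Poly_Mapping.single 0 (c p) * v p) = 0"
  proof (rule poly_mapping_eqI)
    fix q
    have "Poly_Mapping.lookup (Poly_Mapping.single 0 (c p) * v p) q = c p * Poly_Mapping.lookup (v p) q" for p
      by (simp flip: mult_map_scale_conv_mult add: Poly_Mapping.map.rep_eq when_def)
    moreover have "(\<Sum>p\<in>I. c p * Poly_Mapping.lookup (v p) q) = 0"
    proof (cases "q \<in> box (3 * D * N)")
      case False
      then have "Poly_Mapping.lookup (v p) q = 0" if "p \<in> I" for p
        using v[OF that] by (auto simp: supported_on_def in_keys_iff)
      then show ?thesis by simp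
    qed (rule c)
    ultimately show "Poly_Mapping.lookup (\<Sum>p\<in>I. Poly_Mapping.single 0 (c p) * v p) q =
      Poly_Mapping.lookup 0 q"
      by (simp add: lookup_sum)
  qed
  show thesis
  proof (rule that)
    show "\<exists>i<N. \<exists>j<N. \<exists>k<N. c (i, j, k) \<noteq> 0" using c(1) by (auto simp: I_def)
    show "(\<Sum>i<N. (\<Sum>j<N. (\<Sum>k<N. Poly_Mapping.single 0 (c (i, j, k)) * z ^ k) * y ^ j) * x ^ i) = 0"
      using * by (simp add: I_def v_def sum.cartesian_product case_prod_unfold sum_distrib_right mult.assoc)
  qed
qed

lemma (in primeideal) pow_mem_imp:
  "a \<in> carrier R \<Longrightarrow> a [^] (n::nat) \<in> I \<Longrightarrow> a \<in> I"
proof (induction n)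
  case 0
  then show ?case using one_imp_carrier I_notcarr by auto
next
  case (Suc n)
  then show ?case using I_prime[of "a [^] n" a] by auto
qed

lemma semigroup_ring_pow [simp]: "x [^]\<^bsub>semigroup_ring S\<^esub> (n::nat) = x ^ n"
  by (induction n) (simp_all add: nat_pow_def mult.commute)

text \<open>Split off the lowest power of \<open>y\<close> and cancel it modulo the prime.\<close>

lemma primeideal_lowest_term:
  fixes e :: "nat \<Rightarrow> (nat \<times> nat) \<Rightarrow>\<^sub>0 'k::field"
  assumes S: "add_submonoid S" and p: "primeideal p (semigroup_ring S)"
    and y: "y \<in> supported_on S" "y \<notin> p" and e: "\<And>i. e i \<in> supported_on S"
    and sum: "(\<Sum>i<n. e i * y ^ i) \<in> p" and m: "m < n" "\<And>i. i < m \<Longrightarrow> e i = 0"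
  shows "\<exists>g\<in>supported_on S. e m + y * g \<in> p"
proof
  let ?R = "semigroup_ring S :: ((nat \<times> nat) \<Rightarrow>\<^sub>0 'k) ring"
  interpret primeideal p ?R by fact
  have car: "carrier ?R = supported_on S" by (rule carrier_semigroup_ring[OF S])
  define g where "g = (\<Sum>i\<in>{Suc m..<n}. e i * y ^ (i - Suc m))"
  show g: "g \<in> supported_on S"
    unfolding g_def by (intro supported_on_sum supported_on_mult_submonoid[OF S] supported_on_power[OF S] e y)
  have "(\<Sum>i<n. e i * y ^ i) = (\<Sum>i\<in>{m..<n}. e i * y ^ i)"
    using m by (intro sum.mono_neutral_right) auto
  also have "\<dots> = e m * y ^ m + (\<Sum>i\<in>{Suc m..<n}. e i * y ^ i)"
    using m by (simp add: sum.atLeast_Suc_lessThan)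
  also have "(\<Sum>i\<in>{Suc m..<n}. e i * y ^ i) = y ^ Suc m * g"
    unfolding g_def sum_distrib_left
  proof (intro sum.cong refl)
    fix i assume "i \<in> {Suc m..<n}"
    then have "y ^ i = y ^ Suc m * y ^ (i - Suc m)" by (simp flip: power_add del: power_Suc)
    then show "e i * y ^ i = y ^ Suc m * (e i * y ^ (i - Suc m))" by (simp only: mult_ac)
  qed
  finally have "y ^ m * (e m + y * g) \<in> p" using sum by (simp add: algebra_simps)
  moreover have "y ^ m \<in> carrier ?R" "e m + y * g \<in> carrier ?R"
    by (auto simp: car intro!: supported_on_add supported_on_mult_submonoid[OF S] supported_on_power[OF S] e y g)
  ultimately have "y ^ m \<in> p \<or> e m + y * g \<in> p" using I_prime[of "y ^ m" "e m + y * g"] by simp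
  then show "e m + y * g \<in> p" using pow_mem_imp[of y m] y car by auto
qed

text \<open>Complements the splitting off of a lowest term: the error \<open>y * g\<close>, harmless
  modulo a prime without \<open>y\<close>, disappears in the next prime, which contains
  \<open>y\<close>.\<close>

lemma mem_prime_of_add_multiple:
  fixes a y g :: "(nat \<times> nat) \<Rightarrow>\<^sub>0 'k::field"
  assumes S: "add_submonoid S" and p: "ideal p (semigroup_ring S)"
    and "y \<in> p" "g \<in> supported_on S" "a + y * g \<in> p"
  shows "a \<in> p"
proof -
  let ?R = "semigroup_ring S :: ((nat \<times> nat) \<Rightarrow>\<^sub>0 'k) ring"
  interpret ideal p ?R by fact
  have car: "carrier ?R = supported_on S" by (rule carrier_semigroup_ring[OF S])
  have "y * - g \<in> p" using I_r_closed[OF \<open>y \<in> p\<close>, of "- g"] assms car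
    by (simp add: supported_on_uminus)
  from additive_subgroup.a_closed[OF is_additive_subgroup assms(5) this] show ?thesis
    by simp
qed

text \<open>Take a relation between \<open>w\<close>, some \<open>x\<close> in \<open>p1\<close>
  outside \<open>p0\<close> and some \<open>y\<close> in \<open>p2\<close> outside
  \<open>p1\<close>. Peeling off \<open>x\<close> modulo \<open>p0\<close> puts its lowest
  coefficient into \<open>p1\<close>; peeling off \<open>y\<close> modulo \<open>p1\<close> puts a
  polynomial in \<open>w\<close> into \<open>p2\<close>. Only its coefficients are claimed to be not
  all zero; its value could vanish for a general \<open>w\<close>.\<close>

lemma prime_chain_contains_polynomial:
  fixes w :: "(nat \<times> nat) \<Rightarrow>\<^sub>0 'k::field"
  assumes S: "add_submonoid S"
    and p: "primeideal p0 (semigroup_ring S)" "primeideal p1 (semigroup_ring S)" "primeideal p2 (semigroup_ring S)"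
    and less: "p0 \<subset> p1" "p1 \<subset> p2" and w: "w \<in> supported_on S"
  obtains n c where "\<exists>k<n. c k \<noteq> 0" "(\<Sum>k<n. Poly_Mapping.single 0 (c k) * w ^ k) \<in> p2"
proof -
  let ?R = "semigroup_ring S :: ((nat \<times> nat) \<Rightarrow>\<^sub>0 'k) ring"
  have car: "carrier ?R = supported_on S" by (rule carrier_semigroup_ring[OF S])
  have ideals: "ideal p0 ?R" "ideal p1 ?R" "ideal p2 ?R"
    using p by (auto simp: primeideal_def)
  obtain x y where xy: "x \<in> p1" "x \<notin> p0" "y \<in> p2" "y \<notin> p1" using less by blast
  have xyS: "x \<in> supported_on S" "y \<in> supported_on S"
    using ideal.Icarr[OF ideals(2) xy(1)] ideal.Icarr[OF ideals(3) xy(3)] car by auto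
  obtain N C where C: "\<exists>i<N. \<exists>j<N. \<exists>k<N. C i j k \<noteq> 0" and
    rel: "(\<Sum>i<N. (\<Sum>j<N. (\<Sum>k<N. Poly_Mapping.single 0 (C i j k) * w ^ k) * y ^ j) * x ^ i) = 0"
    by (rule algebraically_dependent_three[where x = x and y = y and z = w])
  have zero: "0 \<in> S" using S by (simp add: add_submonoid_def)
  define a where "a i j = (\<Sum>k<N. Poly_Mapping.single 0 (C i j k) * w ^ k)" for i j
  have aS: "a i j \<in> supported_on S" for i j
    unfolding a_def
    by (intro supported_on_sum supported_on_mult_submonoid[OF S] supported_on_power[OF S] w) (simp add: zero)
  define b where "b i = (\<Sum>j<N. a i j * y ^ j)" for i
  have bS: "b i \<in> supported_on S" for i
    unfolding b_def
    by (intro supported_on_sum supported_on_mult_submonoid[OF S] supported_on_power[OF S] aS xyS)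
  \<comment> \<open>Lowest in the formal sense: some coefficient \<open>C i j k\<close> is nonzero.
    The element \<open>b i\<close> itself may be zero; the argument needs only that all earlier ones
    vanish. The same applies to \<open>j\<close> below.\<close>
  define i where "i = (LEAST i. i < N \<and> (\<exists>j<N. \<exists>k<N. C i j k \<noteq> 0))"
  have i: "i < N \<and> (\<exists>j<N. \<exists>k<N. C i j k \<noteq> 0)"
    unfolding i_def using C by (rule LeastI_ex)
  have i0: "C i' j k = 0" if "i' < i" "j < N" "k < N" for i' j k
    using not_less_Least[of i' "\<lambda>i. i < N \<and> (\<exists>j<N. \<exists>k<N. C i j k \<noteq> 0)"] that i
    unfolding i_def[symmetric] by auto
  define j where "j = (LEAST j. j < N \<and> (\<exists>k<N. C i j k \<noteq> 0))"
  have j: "j < N \<and> (\<exists>k<N. C i j k \<noteq> 0)"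
    unfolding j_def using conjunct2[OF i] by (rule LeastI_ex)
  have j0: "C i j' k = 0" if "j' < j" "k < N" for j' k
    using not_less_Least[of j' "\<lambda>j. j < N \<and> (\<exists>k<N. C i j k \<noteq> 0)"] that j
    unfolding j_def[symmetric] by auto
  have "(\<Sum>i<N. b i * x ^ i) \<in> p0"
    using rel additive_subgroup.zero_closed[OF ideal.axioms(1)[OF ideals(1)]] by (simp add: b_def a_def)
  moreover have "b i' = 0" if "i' < i" for i'
    using that i0 by (simp add: b_def a_def)
  ultimately obtain g where "g \<in> supported_on S" "b i + x * g \<in> p0"
    using primeideal_lowest_term[OF S p(1) xyS(1) xy(2), where e = b and n = N and m = i] i bS by blast
  then have "(\<Sum>j<N. a i j * y ^ j) \<in> p1"
    using mem_prime_of_add_multiple[OF S ideals(2) xy(1)] less by (auto simp: b_def)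
  moreover have "a i j' = 0" if "j' < j" for j'
    using that j0 by (simp add: a_def)
  ultimately obtain g where "g \<in> supported_on S" "a i j + y * g \<in> p1"
    using primeideal_lowest_term[OF S p(2) xyS(2) xy(4), where e = "a i" and n = N and m = j] aS j by blast
  then have "a i j \<in> p2"
    using mem_prime_of_add_multiple[OF S ideals(3) xy(3)] less by auto
  with j that show thesis by (auto simp: a_def)
qed

text \<open>With \<open>w\<close> in \<open>p3\<close> outside \<open>p2\<close>, a third peeling of
  the polynomial found in \<open>p2\<close> leaves a nonzero constant, hence a unit, in
  \<open>p3\<close>.\<close>

lemma no_prime_chain_three:
  fixes p0 :: "((nat \<times> nat) \<Rightarrow>\<^sub>0 'k::field) set"
  assumes S: "add_submonoid S"
    and p: "primeideal p0 (semigroup_ring S)" "primeideal p1 (semigroup_ring S)"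
      "primeideal p2 (semigroup_ring S)" "primeideal p3 (semigroup_ring S)"
    and less: "p0 \<subset> p1" "p1 \<subset> p2" "p2 \<subset> p3"
  shows False
proof -
  let ?R = "semigroup_ring S :: ((nat \<times> nat) \<Rightarrow>\<^sub>0 'k) ring"
  have car: "carrier ?R = supported_on S" by (rule carrier_semigroup_ring[OF S])
  have zero: "0 \<in> S" using S by (simp add: add_submonoid_def)
  interpret P: primeideal p3 ?R by fact
  obtain w where w: "w \<in> p3" "w \<notin> p2" using less by blast
  have wS: "w \<in> supported_on S" using P.Icarr[OF w(1)] car by simp
  obtain n c where c: "\<exists>k<n. c k \<noteq> 0" "(\<Sum>k<n. Poly_Mapping.single 0 (c k) * w ^ k) \<in> p2"
    by (rule prime_chain_contains_polynomial[OF S p(1-3) less(1,2) wS])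
  define k where "k = (LEAST k. k < n \<and> c k \<noteq> 0)"
  have k: "k < n \<and> c k \<noteq> 0" unfolding k_def using c(1) by (rule LeastI_ex)
  have k0: "c k' = 0" if "k' < k" for k'
    using not_less_Least[of k' "\<lambda>k. k < n \<and> c k \<noteq> 0"] that k
    unfolding k_def[symmetric] by auto
  obtain g where "g \<in> supported_on S" "Poly_Mapping.single 0 (c k) + w * g \<in> p2"
    using primeideal_lowest_term[OF S p(3) wS w(2), where e = "\<lambda>k. Poly_Mapping.single 0 (c k)" 
        and n = n and m = k] c(2) k k0
    by (auto simp: zero)
  then have "Poly_Mapping.single 0 (c k) \<in> p3"
    using mem_prime_of_add_multiple[OF S P.is_ideal w(1)] less by auto
  moreover have "Poly_Mapping.single 0 (inverse (c k)) \<in> carrier ?R"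
    by (simp add: car zero)
  ultimately have "Poly_Mapping.single 0 (inverse (c k)) * Poly_Mapping.single 0 (c k) \<in> p3"
    using P.I_l_closed by fastforce
  then have "\<one>\<^bsub>?R\<^esub> \<in> p3" using k by (simp add: mult_single)
  then show False using P.one_imp_carrier P.I_notcarr by blast
qed

section \<open>Semigroups with the exchange property\<close>

definition nscale :: "nat \<Rightarrow> nat \<times> nat \<Rightarrow> nat \<times> nat"  (infixr \<open>\<star>\<close> 75) where
  "k \<star> x = (k * fst x, k * snd x)"

lemma nscale_sel [simp]: "fst (k \<star> x) = k * fst x" "snd (k \<star> x) = k * snd x"
  by (simp_all add: nscale_def)

lemma nscale_0 [simp]: "0 \<star> x = 0" and nscale_1 [simp]: "Suc 0 \<star> x = x"
  by (simp_all add: prod_eq_iff)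

lemma nscale_add: "(i + j) \<star> x = i \<star> x + j \<star> x"
  by (simp add: prod_eq_iff algebra_simps)

lemma dickson_nat_pairs:
  fixes M :: "(nat \<times> nat) set"
  shows "\<exists>G\<subseteq>M. finite G \<and> (\<forall>x\<in>M. \<exists>g\<in>G. fst g \<le> fst x \<and> snd g \<le> snd x)"
proof (cases "M = {}")
  case False
  then obtain p q where pq: "(p, q) \<in> M" by auto
  define f where "f i = (LEAST j. (i, j) \<in> M)" for i
  define g where "g j = (LEAST i. (i, j) \<in> M)" for j
  have f: "(i, f i) \<in> M" "f i \<le> j" if "(i, j) \<in> M" for i j
    using that unfolding f_def by (auto intro: LeastI Least_le)
  have g: "(g j, j) \<in> M" "g j \<le> i" if "(i, j) \<in> M" for i j
    using that unfolding g_def by (auto intro: LeastI Least_le)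
  \<comment> \<open>The point \<open>(p, q)\<close> lies below everything in its upper right
    quadrant. What remains meets finitely many columns and rows, each with its lowest point. Empty
    columns and rows give junk values, which the intersection with \<open>M\<close> removes.\<close>
  define G where "G = M \<inter> ({(p, q)} \<union> (\<lambda>i. (i, f i)) ` {..<p} \<union> (\<lambda>j. (g j, j)) ` {..<q})"
  have "\<exists>y\<in>G. fst y \<le> fst x \<and> snd y \<le> snd x" if "x \<in> M" for x
  proof -
    obtain i j where x: "x = (i, j)" by fastforce
    consider "p \<le> i" "q \<le> j" | "i < p" | "j < q" by linarith
    then show ?thesis
    proof cases
      case 1
      then show ?thesis using pq by (intro bexI[of _ "(p, q)"]) (auto simp: x G_def)
    next
      case 2
      then show ?thesis using f[of i j] that by (intro bexI[of _ "(i, f i)"]) (auto simp: x G_def)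
    next
      case 3
      then show ?thesis using g[of i j] that by (intro bexI[of _ "(g j, j)"]) (auto simp: x G_def)
    qed
  qed
  moreover have "G \<subseteq> M" "finite G" by (auto simp: G_def)
  ultimately show ?thesis by blast
qed auto

text \<open>The vector \<open>y\<close> in \<open>exchange\<close> equals both
  \<open>x - j \<star> n2\<close> and \<open>z - i \<star> n1\<close>. The assumption thus says that
  an integral vector that enters \<open>P\<close> by adding a multiple of \<open>n1\<close>, and
  also by adding a multiple of \<open>n2\<close>, already lies in \<open>P\<close>: the usual
  Cohen-Macaulay criterion for simplicial affine semigroups.\<close>

locale cohen_macaulay_semigroup =
  fixes P :: "(nat \<times> nat) set" and n1 n2 :: "nat \<times> nat"
  assumes submonoid: "add_submonoid P"
    and n1: "n1 \<in> P" and n2: "n2 \<in> P"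
    and independent: "fst n1 * snd n2 \<noteq> snd n1 * fst n2"
    and exchange: "\<lbrakk>x \<in> P; z \<in> P; x + i \<star> n1 = z + j \<star> n2\<rbrakk> \<Longrightarrow> \<exists>y\<in>P. x = y + j \<star> n2"
begin

lemma zero_mem: "0 \<in> P" and add_mem: "x \<in> P \<Longrightarrow> y \<in> P \<Longrightarrow> x + y \<in> P"
  using submonoid by (auto simp: add_submonoid_def)

lemma nscale_mem: "x \<in> P \<Longrightarrow> k \<star> x \<in> P"
proof (induction k)
  case (Suc k)
  then show ?case using add_mem[of "k \<star> x" x] nscale_add[of k 1 x] by simp
qed (simp add: zero_mem)

lemma exchange':
  assumes "x \<in> P" "z \<in> P" "x + i \<star> n1 = z + j \<star> n2"
  shows "\<exists>y\<in>P. z = y + i \<star> n1"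
proof -
  obtain y where "y \<in> P" "x = y + j \<star> n2" using exchange[OF assms] by auto
  with assms(3) have "z = y + i \<star> n1" by (simp add: prod_eq_iff)
  with \<open>y \<in> P\<close> show ?thesis by blast
qed

text \<open>The Apery set of \<open>P\<close> with respect to \<open>n1\<close> and
  \<open>n2\<close>; its monomials are the module basis of the semigroup ring over the polynomials
  in \<open>t^n1\<close> and \<open>t^n2\<close>.\<close>

definition basis :: "(nat \<times> nat) set" where
  "basis = {b \<in> P. \<not> (\<exists>y\<in>P. b = y + n1) \<and> \<not> (\<exists>y\<in>P. b = y + n2)}"

lemma basis_minimal:
  assumes "b \<in> basis" "y \<in> P" "b = y + i \<star> n1 + j \<star> n2"
  shows "i = 0 \<and> j = 0"
proof (rule ccontr)
  assume "\<not> (i = 0 \<and> j = 0)"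
  then consider i' where "i = Suc i'" | j' where "j = Suc j'" by (metis not0_implies_Suc)
  then show False
  proof cases
    case 1
    then have "b = (y + i' \<star> n1 + j \<star> n2) + n1"
      using assms(3) by (simp add: prod_eq_iff)
    moreover have "y + i' \<star> n1 + j \<star> n2 \<in> P"
      using assms(2) by (intro add_mem nscale_mem n1 n2)
    ultimately show False using assms(1) by (auto simp: basis_def)
  next
    case 2
    then have "b = (y + i \<star> n1 + j' \<star> n2) + n2"
      using assms(3) by (simp add: prod_eq_iff)
    moreover have "y + i \<star> n1 + j' \<star> n2 \<in> P"
      using assms(2) by (intro add_mem nscale_mem n1 n2)
    ultimately show False using assms(1) by (auto simp: basis_def)
  qed
qed

text \<open>Write the integral coefficients as differences of natural numbers. If their signs agree,
  one of the two elements is the other plus multiples of \<open>n1\<close> and \<open>n2\<close>,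
  against minimality. If the signs differ, the exchange property splits a multiple of
  \<open>n2\<close> off one element and of \<open>n1\<close> off the other, again against
  minimality.\<close>

lemma basis_eq_of_lattice:
  assumes b: "b \<in> basis" "b' \<in> basis"
    and eq: "int (fst b) = int (fst b') + i * int (fst n1) + j * int (fst n2)"
      "int (snd b) = int (snd b') + i * int (snd n1) + j * int (snd n2)"
  shows "b = b'"
proof -
  have bP: "b \<in> P" "b' \<in> P" using b by (auto simp: basis_def)
  have nat_cases: "\<exists>k k'. m = int k' - int k \<and> (k = 0 \<or> k' = 0)" for m
    by (rule exI[of _ "nat (- m)"], rule exI[of _ "nat m"]) auto
  obtain k1 k2 where k: "i = int k2 - int k1" "k1 = 0 \<or> k2 = 0" using nat_cases by blast
  obtain l1 l2 where l: "j = int l2 - int l1" "l1 = 0 \<or> l2 = 0" using nat_cases by blast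
  have "int (fst b + k1 * fst n1 + l1 * fst n2) = int (fst b' + k2 * fst n1 + l2 * fst n2)"
    "int (snd b + k1 * snd n1 + l1 * snd n2) = int (snd b' + k2 * snd n1 + l2 * snd n2)"
    unfolding of_nat_add of_nat_mult eq k(1) l(1) by (simp_all add: algebra_simps)
  then have *: "b + k1 \<star> n1 + l1 \<star> n2 = b' + k2 \<star> n1 + l2 \<star> n2"
    unfolding of_nat_eq_iff by (simp add: prod_eq_iff)
  have "k1 = 0 \<and> k2 = 0 \<and> l1 = 0 \<and> l2 = 0"
  proof -
    consider "k1 = 0" "l1 = 0" | "k2 = 0" "l2 = 0" | "k1 = 0" "l2 = 0" | "k2 = 0" "l1 = 0"
      using k(2) l(2) by blast
    then show ?thesis
    proof cases
      case 1
      then show ?thesis using basis_minimal[OF b(1) bP(2), of k2 l2] * by simp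
    next
      case 2
      then show ?thesis using basis_minimal[OF b(2) bP(1), of k1 l1] * by simp
    next
      case 3
      then have e: "b' + k2 \<star> n1 = b + l1 \<star> n2" using * by simp
      obtain y y' where "y \<in> P" "b' = y + l1 \<star> n2" "y' \<in> P" "b = y' + k2 \<star> n1"
        using exchange[OF bP(2,1) e] exchange'[OF bP(2,1) e] by auto
      then show ?thesis
        using basis_minimal[OF b(2), of y 0 l1] basis_minimal[OF b(1), of y' k2 0] 3 by simp
    next
      case 4
      then have e: "b + k1 \<star> n1 = b' + l2 \<star> n2" using * by simp
      obtain y y' where "y \<in> P" "b = y + l2 \<star> n2" "y' \<in> P" "b' = y' + k1 \<star> n1"
        using exchange[OF bP e] exchange'[OF bP e] by auto
      then show ?thesis
        using basis_minimal[OF b(1), of y 0 l2] basis_minimal[OF b(2), of y' k1 0] 4 by simp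
    qed
  qed
  with * show ?thesis by simp
qed

text \<open>By Cramer's rule, vectors that are congruent modulo the determinant differ by an
  integral combination of \<open>n1\<close> and \<open>n2\<close>.\<close>

lemma finite_basis: "finite basis"
proof -
  define D where "D = int (fst n1) * int (snd n2) - int (snd n1) * int (fst n2)"
  have D: "D \<noteq> 0" unfolding D_def using independent by (simp flip: of_nat_mult)
  define \<rho> where "\<rho> b = (int (fst b) mod \<bar>D\<bar>, int (snd b) mod \<bar>D\<bar>)" for b :: "nat \<times> nat"
  have "inj_on \<rho> basis"
  proof (rule inj_onI)
    fix b b' assume b: "b \<in> basis" "b' \<in> basis" "\<rho> b = \<rho> b'"
    then have "\<bar>D\<bar> dvd int (fst b) - int (fst b')" "\<bar>D\<bar> dvd int (snd b) - int (snd b')"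
      by (auto simp: \<rho>_def mod_eq_dvd_iff)
    then have "D dvd int (fst b) - int (fst b')" "D dvd int (snd b) - int (snd b')"
      by simp_all
    then obtain e f where "int (fst b) - int (fst b') = D * e" "int (snd b) - int (snd b') = D * f"
      by (auto simp: dvd_def)
    then show "b = b'"
      by (intro basis_eq_of_lattice[OF b(1,2), of "e * int (snd n2) - f * int (fst n2)"
            "f * int (fst n1) - e * int (snd n1)"]) (auto simp: D_def algebra_simps)
  qed
  moreover have "\<rho> ` basis \<subseteq> {0..<\<bar>D\<bar>} \<times> {0..<\<bar>D\<bar>}"
    using D by (auto simp: \<rho>_def)
  ultimately show ?thesis
    by (meson finite_SigmaI finite_atLeastLessThan_int inj_on_finite)
qed

lemma generators_nonzero: "fst n1 + snd n1 > 0" "fst n2 + snd n2 > 0"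
  using independent by (auto intro!: Nat.gr0I)

text \<open>Subtracting \<open>n1\<close> or \<open>n2\<close> while staying in \<open>P\<close>
  must stop, since each step lowers the coordinate sum.\<close>

lemma basis_representation:
  "x \<in> P \<Longrightarrow> \<exists>b\<in>basis. \<exists>i j. x = b + i \<star> n1 + j \<star> n2"
proof (induction "fst x + snd x" arbitrary: x rule: less_induct)
  case less
  show ?case
  proof (cases "x \<in> basis")
    case True
    then show ?thesis by (intro bexI[of _ x] exI[of _ 0]) auto
  next
    case False
    with less.prems consider y where "y \<in> P" "x = y + n1" | y where "y \<in> P" "x = y + n2"
      by (auto simp: basis_def)
    then show ?thesis
    proof cases
      case 1
      then obtain b i j where "b \<in> basis" "y = b + i \<star> n1 + j \<star> n2"
        using less.hyps[of y] generators_nonzero by auto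
      then show ?thesis using 1
        by (intro bexI[of _ b] exI[of _ "Suc i"] exI[of _ j]) (auto simp: prod_eq_iff)
    next
      case 2
      then obtain b i j where "b \<in> basis" "y = b + i \<star> n1 + j \<star> n2"
        using less.hyps[of y] generators_nonzero by auto
      then show ?thesis using 2
        by (intro bexI[of _ b] exI[of _ i] exI[of _ "Suc j"]) (auto simp: prod_eq_iff)
    qed
  qed
qed

lemma affine: "affine_semigroup P"
proof -
  let ?G = "basis \<union> {n1, n2}"
  have "P = add_submonoid hull ?G"
  proof (rule hull_unique[symmetric])
    show "?G \<subseteq> P" using n1 n2 by (auto simp: basis_def)
    show "add_submonoid P" by (rule submonoid)
    fix T assume T: "?G \<subseteq> T" "add_submonoid T"
    have sc: "k \<star> x \<in> T" if "x \<in> T" for k x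
    proof (induction k)
      case (Suc k)
      then show ?case using T(2) that nscale_add[of k 1 x] by (simp add: add_submonoid_def)
    qed (use T(2) in \<open>simp add: add_submonoid_def\<close>)
    show "P \<subseteq> T"
    proof
      fix x assume "x \<in> P"
      then obtain b i j where "b \<in> basis" "x = b + i \<star> n1 + j \<star> n2"
        using basis_representation by blast
      moreover have "i \<star> n1 \<in> T" "j \<star> n2 \<in> T" "b \<in> T" using sc T \<open>b \<in> basis\<close> by auto
      ultimately show "x \<in> T" using T(2) by (auto simp: add_submonoid_def)
    qed
  qed
  moreover have "finite ?G" using finite_basis by simp
  ultimately show ?thesis unfolding affine_semigroup_def by (intro exI[of _ ?G] conjI)
qed

text \<open>\<open>P\<close> is a finite union of translates
  \<open>b + i \<star> n1 + j \<star> n2\<close>, and Dickson's lemma applies to the pairs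
  \<open>(i, j)\<close> of each translate; the differences are multiples of \<open>n1\<close> and
  \<open>n2\<close>, hence in \<open>P\<close>.\<close>

lemma divisor_finite: "divisor_finite P"
  unfolding divisor_finite_def
proof (intro allI impI)
  fix M assume M: "M \<subseteq> P"
  define E where "E b = {p. b + fst p \<star> n1 + snd p \<star> n2 \<in> M}" for b
  have "\<forall>b. \<exists>G\<subseteq>E b. finite G \<and> (\<forall>x\<in>E b. \<exists>g\<in>G. fst g \<le> fst x \<and> snd g \<le> snd x)"
    using dickson_nat_pairs by blast
  then obtain G where G: "\<And>b. G b \<subseteq> E b" "\<And>b. finite (G b)"
    "\<And>b x. x \<in> E b \<Longrightarrow> \<exists>g\<in>G b. fst g \<le> fst x \<and> snd g \<le> snd x" by metis
  define H where "H = (\<Union>b\<in>basis. (\<lambda>p. b + fst p \<star> n1 + snd p \<star> n2) ` G b)"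
  have "H \<subseteq> M" using G(1) unfolding H_def E_def by blast
  moreover have "finite H" using G(2) finite_basis by (auto simp: H_def)
  moreover have "\<exists>g\<in>H. \<exists>s\<in>P. x = s + g" if x: "x \<in> M" for x
  proof -
    obtain b i j where b: "b \<in> basis" "x = b + i \<star> n1 + j \<star> n2"
      using basis_representation M x by blast
    then have "(i, j) \<in> E b" using x by (simp add: E_def)
    then obtain k l where kl: "(k, l) \<in> G b" "k \<le> i" "l \<le> j"
      using G(3) by fastforce
    have "x = ((i - k) \<star> n1 + (j - l) \<star> n2) + (b + k \<star> n1 + l \<star> n2)"
      using kl(2,3) nscale_add[of "i - k" k n1] nscale_add[of "j - l" l n2]
      by (simp add: b(2) add_ac)
    moreover have "(i - k) \<star> n1 + (j - l) \<star> n2 \<in> P"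
      by (intro add_mem nscale_mem n1 n2)
    moreover have "b + k \<star> n1 + l \<star> n2 \<in> H" using b kl by (force simp: H_def)
    ultimately show ?thesis by blast
  qed
  ultimately show "\<exists>G\<subseteq>M. finite G \<and> (\<forall>x\<in>M. \<exists>g\<in>G. \<exists>s\<in>P. x = s + g)" by blast
qed

text \<open>Division with remainder by \<open>q\<close>: its leading monomial is \<open>e \<star> n2\<close>, and remainders are
  supported on the exponents of \<open>P\<close> that are not \<open>e \<star> n2\<close> plus an element of \<open>P\<close>. By the
  exchange property this set of exponents is stable under addition of multiples of \<open>n1\<close>.\<close>

lemma dvd_of_mult_eq_mult:
  fixes \<alpha> \<beta> p q :: "(nat \<times> nat) \<Rightarrow>\<^sub>0 'k::field"
  assumes p: "p \<in> supported_on (range (\<lambda>i. i \<star> n1))" "p \<noteq> 0"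
    and q: "q \<in> supported_on (range (\<lambda>i. i \<star> n2))" "q \<noteq> 0"
    and \<alpha>: "\<alpha> \<in> supported_on P" and \<beta>: "\<beta> \<in> supported_on P"
    and eq: "\<alpha> * p = \<beta> * q"
  shows "\<exists>\<gamma>\<in>supported_on P. \<alpha> = \<gamma> * q"
proof -
  define J where "J = {i. i \<star> n2 \<in> Poly_Mapping.keys q}"
  have inj: "i = j" if "i \<star> n2 = j \<star> n2" for i j
    using that generators_nonzero(2) by (auto simp: prod_eq_iff)
  have "inj_on (\<lambda>i. i \<star> n2) J" using inj by (auto simp: inj_on_def)
  moreover have "(\<lambda>i. i \<star> n2) ` J \<subseteq> Poly_Mapping.keys q" by (auto simp: J_def)
  ultimately have J: "finite J" by (meson finite_keys inj_on_finite)
  have keys_q: "\<exists>i\<in>J. x = i \<star> n2" if "x \<in> Poly_Mapping.keys q" for x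
    using q(1) that by (auto simp: supported_on_def J_def)
  have "J \<noteq> {}" using keys_q q(2) by (metis equals0I ex_in_conv keys_eq_empty)
  define e where "e = Max J"
  have e: "e \<in> J" "\<And>i. i \<in> J \<Longrightarrow> i \<le> e" using J \<open>J \<noteq> {}\<close> by (auto simp: e_def)
  define c where "c = Poly_Mapping.lookup q (e \<star> n2)"
  have c: "c \<noteq> 0" using e(1) by (auto simp: J_def c_def in_keys_iff)
  define q' where "q' = q - Poly_Mapping.single (e \<star> n2) c"
  have keys_q': "\<exists>i<e. x = i \<star> n2" if "x \<in> Poly_Mapping.keys q'" for x
  proof -
    have "x \<noteq> e \<star> n2" using that by (auto simp: q'_def in_keys_iff lookup_minus c_def)
    then have "x \<in> Poly_Mapping.keys q"
      using that by (auto simp: q'_def in_keys_iff lookup_minus lookup_single_not_eq)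
    with keys_q e \<open>x \<noteq> e \<star> n2\<close> show ?thesis by (metis le_neq_implies_less)
  qed
  have qP: "q \<in> supported_on P"
    using keys_q nscale_mem[OF n2] by (fastforce simp: supported_on_def)
  define L where "L = {x \<in> P. \<not> (\<exists>y\<in>P. x = y + e \<star> n2)}"
  define D where "D = {\<gamma> * q + \<rho> | \<gamma> \<rho>. \<gamma> \<in> supported_on P \<and> \<rho> \<in> supported_on L}"
  have D_zero: "0 \<in> D"
    by (auto simp: D_def intro!: exI[of _ "0 :: (nat \<times> nat) \<Rightarrow>\<^sub>0 'k"])
  have D_add: "f + g \<in> D" if fg: "f \<in> D" "g \<in> D" for f g
  proof -
    obtain \<gamma> \<rho> \<gamma>' \<rho>' where "f = \<gamma> * q + \<rho>" "\<gamma> \<in> supported_on P" "\<rho> \<in> supported_on L"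
      "g = \<gamma>' * q + \<rho>'" "\<gamma>' \<in> supported_on P" "\<rho>' \<in> supported_on L"
      using fg by (auto simp: D_def)
    then show ?thesis unfolding D_def
      by (intro CollectI exI[of _ "\<gamma> + \<gamma>'"] exI[of _ "\<rho> + \<rho>'"])
        (auto simp: algebra_simps intro: supported_on_add)
  qed
  have D_single: "Poly_Mapping.single x d \<in> D" if "x \<in> P" for x d
    using that
  proof (induction "fst x + snd x" arbitrary: x d rule: less_induct)
    case less
    show ?case
    proof (cases "x \<in> L")
      case True
      then show ?thesis unfolding D_def
        by (intro CollectI exI[of _ 0] exI[of _ "Poly_Mapping.single x d"]) auto
    next
      case False
      with less.prems obtain y where y: "y \<in> P" "x = y + e \<star> n2" by (auto simp: L_def)
      define m where "m = Poly_Mapping.single y (d / c)"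
      have "Poly_Mapping.single x d = m * Poly_Mapping.single (e \<star> n2) c"
        using c by (simp add: m_def mult_single y(2))
      also have "\<dots> = m * q + (- m) * q'"
        by (simp add: q'_def algebra_simps)
      finally have *: "Poly_Mapping.single x d = m * q + (- m) * q'" .
      have mP: "m \<in> supported_on P" using y by (simp add: m_def)
      have "m * q \<in> D" unfolding D_def
        by (intro CollectI exI[of _ m] exI[of _ 0]) (auto simp: mP)
      moreover have "(- m) * q' \<in> D"
      proof (rule supported_on_induct[where Q = "\<lambda>f. f \<in> D"])
        show "(- m) * q' \<in> supported_on {y + i \<star> n2 | i. i < e}"
        proof (rule supported_on_mult)
          show "- m \<in> supported_on {y}" by (intro supported_on_uminus) (simp add: m_def)
          show "q' \<in> supported_on {i \<star> n2 | i. i < e}"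
            using keys_q' by (auto simp: supported_on_def)
        qed auto
        fix z d assume "z \<in> {y + i \<star> n2 | i. i < e}"
        then obtain i where i: "i < e" "z = y + i \<star> n2" by auto
        \<comment> \<open>The terms that replace the leading one are smaller multiples of
          \<open>n2\<close>, so the coordinate sum drops and the induction hypothesis
          applies.\<close>
        have "i * (fst n2 + snd n2) < e * (fst n2 + snd n2)"
          using i generators_nonzero(2) by simp
        then have "fst z + snd z < fst x + snd x"
          by (simp add: i y algebra_simps)
        moreover have "z \<in> P" using y i n2 by (auto intro: add_mem nscale_mem)
        ultimately show "Poly_Mapping.single z d \<in> D" by (rule less.hyps)
      qed (use D_zero D_add in auto)
      ultimately show ?thesis unfolding * by (rule D_add)
    qed
  qed
  have "\<alpha> \<in> D"
    using \<alpha> by (rule supported_on_induct) (auto intro: D_zero D_add D_single)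
  then obtain \<gamma> \<rho> where \<gamma>: "\<gamma> \<in> supported_on P" "\<rho> \<in> supported_on L" "\<alpha> = \<gamma> * q + \<rho>"
    by (auto simp: D_def)
  \<comment> \<open>Uniqueness of the remainder: the equation reduces to
    \<open>\<rho> * p = \<delta> * q\<close>. The left side keeps its support in \<open>L\<close>,
    whereas a nonzero right side has an exponent outside \<open>L\<close>; so both sides
    vanish.\<close>
  define \<delta> where "\<delta> = \<beta> - \<gamma> * p"
  have pP: "p \<in> supported_on P"
    using p(1) nscale_mem[OF n1] by (fastforce simp: supported_on_def)
  have \<delta>P: "\<delta> \<in> supported_on P" unfolding \<delta>_def
    by (intro supported_on_diff \<beta> supported_on_mult_submonoid[OF submonoid] \<gamma> pP)
  have eq': "\<rho> * p = \<delta> * q"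
    using eq by (simp add: \<gamma> \<delta>_def algebra_simps)
  have \<rho>pL: "\<rho> * p \<in> supported_on L"
  proof (rule supported_on_mult[OF \<gamma>(2) p(1)])
    fix x w assume xw: "x \<in> L" "w \<in> range (\<lambda>i. i \<star> n1)"
    then obtain i where i: "w = i \<star> n1" by auto
    have xP: "x \<in> P" using xw by (simp add: L_def)
    have "\<not> (\<exists>y\<in>P. x + w = y + e \<star> n2)"
      using exchange[OF xP, of _ i e] xw by (auto simp: i L_def)
    then show "x + w \<in> L" using xP i n1 by (auto simp: L_def intro: add_mem nscale_mem)
  qed
  have "\<delta> = 0"
  proof (rule ccontr)
    assume "\<delta> \<noteq> 0"
    then have ne: "Poly_Mapping.keys \<delta> \<noteq> {}" by simp
    define s where "s x = fst x + snd x" for x :: "nat \<times> nat"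
    \<comment> \<open>An exponent of maximal coordinate sum, paired with the largest multiple
      \<open>e\<close> of \<open>n2\<close> in \<open>q\<close>, yields
      \<open>x + e \<star> n2\<close> in a single way, so this exponent survives in the product
      although it cannot lie in \<open>L\<close>.\<close>
    obtain x where x: "x \<in> Poly_Mapping.keys \<delta>" "s x = Max (s ` Poly_Mapping.keys \<delta>)"
      using Max_in[of "s ` Poly_Mapping.keys \<delta>"] ne by fastforce
    have x_max: "s y \<le> s x" if "y \<in> Poly_Mapping.keys \<delta>" for y
      unfolding x(2) using that by simp
    have "Poly_Mapping.lookup (\<delta> * q) (x + e \<star> n2) = Poly_Mapping.lookup \<delta> x * Poly_Mapping.lookup q (e \<star> n2)"
    proof (rule lookup_mult_unique)
      fix y w assume yw: "y \<in> Poly_Mapping.keys \<delta>" "w \<in> Poly_Mapping.keys q" "y + w = x + e \<star> n2"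
      obtain i where i: "i \<in> J" "w = i \<star> n2" using keys_q[OF yw(2)] by blast
      have "s y + i * s n2 = s x + e * s n2"
        using yw(3) by (simp add: i s_def prod_eq_iff algebra_simps)
      moreover have "s y \<le> s x" "s n2 > 0" using x_max yw generators_nonzero by (auto simp: s_def)
      ultimately have "e * s n2 \<le> i * s n2" by linarith
      with \<open>s n2 > 0\<close> have "e \<le> i" by simp
      with e i have "i = e" by force
      with yw(3) i show "y = x \<and> w = e \<star> n2" by simp
    qed
    then have "x + e \<star> n2 \<in> Poly_Mapping.keys (\<rho> * p)"
      using x(1) c by (simp add: eq' in_keys_iff c_def)
    then have "x + e \<star> n2 \<in> L" using \<rho>pL by (auto simp: supported_on_def)
    moreover have "x \<in> P" using x(1) \<delta>P by (auto simp: supported_on_def)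
    ultimately show False by (auto simp: L_def)
  qed
  then have "\<rho> = 0" using eq' p(2) by (simp add: poly_mapping_mult_eq_0_iff)
  then show ?thesis using \<gamma> by auto
qed

end

section \<open>Triangles\<close>

definition cross :: "real \<times> real \<Rightarrow> real \<times> real \<Rightarrow> real" where
  "cross u v = fst u * snd v - snd u * fst v"

lemma collinear_if_cross_eq_0:
  assumes "u \<noteq> 0" "\<And>x. x \<in> S \<Longrightarrow> cross u x = 0"
  shows "collinear S"
proof -
  have mult: "\<exists>k. x = k *\<^sub>R u" if "x \<in> S" for x
  proof (cases "fst u = 0")
    case True
    then show ?thesis using assms(1) assms(2)[OF that]
      by (intro exI[of _ "snd x / snd u"]) (auto simp: cross_def prod_eq_iff)
  next
    case False
    then show ?thesis using assms(2)[OF that]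
      by (intro exI[of _ "fst x / fst u"]) (auto simp: cross_def prod_eq_iff field_simps)
  qed
  show ?thesis unfolding collinear_def
  proof (intro exI[of _ u] ballI)
    fix x y assume "x \<in> S" "y \<in> S"
    then obtain k l where "x = k *\<^sub>R u" "y = l *\<^sub>R u" using mult by blast
    then show "\<exists>c. x - y = c *\<^sub>R u" by (metis scaleR_left_diff_distrib)
  qed
qed

lemma cross_zero [simp]: "cross 0 u = 0" "cross u 0 = 0"
  by (simp_all add: cross_def)

text \<open>Cramer's identity \<open>cross b c * a + cross c a * b + cross a b * c = 0\<close>,
  solved for \<open>c\<close>; the sign hypotheses make both coefficients nonnegative.\<close>

lemma middle_vector_combination:
  assumes "cross a b \<noteq> 0" "cross b c * cross a b \<le> 0" "cross c a * cross a b \<le> 0"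
  shows "\<exists>\<sigma> \<tau>. 0 \<le> \<sigma> \<and> 0 \<le> \<tau> \<and> c = \<sigma> *\<^sub>R a + \<tau> *\<^sub>R b"
proof (intro exI conjI)
  show "0 \<le> - cross b c / cross a b" "0 \<le> - cross c a / cross a b"
    using assms by (auto simp: mult_le_0_iff zero_le_divide_iff divide_le_0_iff)
  show "c = (- cross b c / cross a b) *\<^sub>R a + (- cross c a / cross a b) *\<^sub>R b"
    using assms(1) by (auto simp: prod_eq_iff field_simps) (simp_all add: cross_def algebra_simps)
qed

text \<open>The vertices are regarded as vectors from the origin, one of which may be zero.
  Noncollinearity ensures that not all three cross products vanish, and nonnegative coordinates
  restrict their signs. The coefficients of Cramer's identity then reveal which vertex lies between
  the others.\<close>

lemma triangle_order:
  assumes quad: "{a, b, c} \<subseteq> nonneg_quadrant" and noncol: "\<not> collinear {a, b, c}"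
  obtains u v w \<sigma> \<tau> where "{u, v, w} = {a, b, c}" "cross u v \<noteq> 0"
    "0 \<le> \<sigma>" "0 \<le> \<tau>" "w = \<sigma> *\<^sub>R u + \<tau> *\<^sub>R v"
proof -
  define bc where "bc = cross b c"
  define ca where "ca = cross c a"
  define ab where "ab = cross a b"
  have nz: "bc \<noteq> 0 \<or> ca \<noteq> 0 \<or> ab \<noteq> 0"
  proof (rule ccontr)
    assume *: "\<not> (bc \<noteq> 0 \<or> ca \<noteq> 0 \<or> ab \<noteq> 0)"
    have "collinear {a, b, c}" if "u \<in> {a, b, c}" "u \<noteq> 0" for u
      using that * by (intro collinear_if_cross_eq_0[OF that(2)])
        (auto simp: bc_def ca_def ab_def cross_def algebra_simps)
    moreover have "collinear {a, b, c}" if "a = 0" "b = 0" "c = 0"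
      using that by simp
    ultimately show False using noncol by blast
  qed
  have rel: "bc * fst a + ca * fst b + ab * fst c = 0" "bc * snd a + ca * snd b + ab * snd c = 0"
    by (auto simp: bc_def ca_def ab_def cross_def algebra_simps)
  text \<open>Two of the coefficients in \<open>rel\<close> cannot have the same strict sign while the third one
    has the same weak sign: two of the vectors would vanish.\<close>
  have zero: "p = 0 \<and> q = 0"
    if "x > 0" "y > 0" "z \<ge> 0" "0 \<le> p" "0 \<le> q" "0 \<le> r" "x * p + y * q + z * r = 0"
    for x y z p q r :: real
  proof -
    have "0 \<le> x * p" "0 \<le> y * q" "0 \<le> z * r" using that by auto
    then have "x * p = 0" "y * q = 0" using that(7) by linarith+
    then show ?thesis using that by simp
  qed
  have vec: "u = 0 \<and> v = 0"
    if "x > 0 \<and> y > 0 \<and> z \<ge> 0 \<or> x < 0 \<and> y < 0 \<and> z \<le> 0"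
      "{u, v, w} = {a, b, c}"
      "x * fst u + y * fst v + z * fst w = 0" "x * snd u + y * snd v + z * snd w = 0"
    for x y z u v w
  proof -
    have n: "0 \<le> fst u" "0 \<le> snd u" "0 \<le> fst v" "0 \<le> snd v" "0 \<le> fst w" "0 \<le> snd w"
      using quad unfolding that(2)[symmetric] by (auto simp: nonneg_quadrant_def)
    from that(1) show ?thesis
    proof
      assume "x > 0 \<and> y > 0 \<and> z \<ge> 0"
      then show ?thesis using n that(3,4) zero[of x y z "fst u" "fst v" "fst w"]
          zero[of x y z "snd u" "snd v" "snd w"] by (auto simp: prod_eq_iff)
    next
      assume "x < 0 \<and> y < 0 \<and> z \<le> 0"
      then show ?thesis using n that(3,4) zero[of "-x" "-y" "-z" "fst u" "fst v" "fst w"]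
          zero[of "-x" "-y" "-z" "snd u" "snd v" "snd w"] by (auto simp: prod_eq_iff)
    qed
  qed
  have XY: "\<not> (bc > 0 \<and> ca > 0 \<and> ab \<ge> 0 \<or> bc < 0 \<and> ca < 0 \<and> ab \<le> 0)"
    using vec[of bc ca ab a b c] rel by (auto simp: bc_def)
  have YZ: "\<not> (ca > 0 \<and> ab > 0 \<and> bc \<ge> 0 \<or> ca < 0 \<and> ab < 0 \<and> bc \<le> 0)"
    using vec[of ca ab bc b c a] rel by (auto simp: ca_def insert_commute algebra_simps)
  have ZX: "\<not> (ab > 0 \<and> bc > 0 \<and> ca \<ge> 0 \<or> ab < 0 \<and> bc < 0 \<and> ca \<le> 0)"
    using vec[of ab bc ca c a b] rel by (auto simp: ab_def insert_commute algebra_simps)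
  \<comment> \<open>The excluded patterns leave a nonzero coefficient whose sign is weakly opposite
    to both others. The vertex that carries it in \<open>rel\<close> becomes
    \<open>w\<close>.\<close>
  have "ab \<noteq> 0 \<and> bc * ab \<le> 0 \<and> ca * ab \<le> 0 \<or> bc \<noteq> 0 \<and> ca * bc \<le> 0 \<and> ab * bc \<le> 0 \<or>
      ca \<noteq> 0 \<and> ab * ca \<le> 0 \<and> bc * ca \<le> 0"
    using nz XY YZ ZX unfolding mult_le_0_iff by argo
  then consider "ab \<noteq> 0" "bc * ab \<le> 0" "ca * ab \<le> 0" | "bc \<noteq> 0" "ca * bc \<le> 0" "ab * bc \<le> 0"
    | "ca \<noteq> 0" "ab * ca \<le> 0" "bc * ca \<le> 0"
    by blast
  then show thesis
  proof cases
    case 1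
    with middle_vector_combination[of a b c] that[of a b c] show thesis
      by (auto simp: bc_def ca_def ab_def)
  next
    case 2
    with middle_vector_combination[of b c a] that[of b c a] show thesis
      by (auto simp: bc_def ca_def ab_def insert_commute)
  next
    case 3
    with middle_vector_combination[of c a b] that[of c a b] show thesis
      by (auto simp: bc_def ca_def ab_def insert_commute)
  qed
qed

lemma nonneg_rational_point_multiple:
  assumes "rational_point x" "x \<in> nonneg_quadrant"
  obtains k :: nat and n :: "nat \<times> nat"
    where "k > 0" "(real (fst n), real (snd n)) = real k *\<^sub>R x"
proof -
  obtain m d where m: "d \<noteq> 0" "\<bar>fst x\<bar> = real m / real d"
    using assms(1) unfolding rational_point_def by (metis Rats_abs_nat_div_natE)
  obtain m' d' where m': "d' \<noteq> 0" "\<bar>snd x\<bar> = real m' / real d'"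
    using assms(1) unfolding rational_point_def by (metis Rats_abs_nat_div_natE)
  have "fst x = real m / real d" "snd x = real m' / real d'"
    using assms(2) m m' by (auto simp: nonneg_quadrant_def)
  then show thesis
    using m(1) m'(1) by (intro that[of "d * d'" "(m * d', m' * d)"]) (auto simp: prod_eq_iff)
qed

text \<open>The scaling factor is absorbed into the barycentric weights, which then sum to
  \<open>i\<close> instead of one. In this form adding two points adds their weights and their
  factors.\<close>

lemma mem_convex_body_semigroup_triangle:
  "p \<in> convex_body_semigroup (convex hull {u, v, w}) \<longleftrightarrow>
     (\<exists>(i::nat) \<alpha> \<beta> \<gamma>. 0 \<le> \<alpha> \<and> 0 \<le> \<beta> \<and> 0 \<le> \<gamma> \<and> \<alpha> + \<beta> + \<gamma> = real i \<and>
        (real (fst p), real (snd p)) = \<alpha> *\<^sub>R u + \<beta> *\<^sub>R v + \<gamma> *\<^sub>R w)"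
  (is "_ \<longleftrightarrow> (\<exists>i \<alpha> \<beta> \<gamma>. ?Q i \<alpha> \<beta> \<gamma>)")
proof
  assume "p \<in> convex_body_semigroup (convex hull {u, v, w})"
  then obtain i :: nat and \<alpha> \<beta> \<gamma> where "0 \<le> \<alpha>" "0 \<le> \<beta>" "0 \<le> \<gamma>" "\<alpha> + \<beta> + \<gamma> = 1"
    "(real (fst p), real (snd p)) = real i *\<^sub>R (\<alpha> *\<^sub>R u + \<beta> *\<^sub>R v + \<gamma> *\<^sub>R w)"
    unfolding convex_body_semigroup_def convex_hull_3 by blast
  then have "?Q i (real i * \<alpha>) (real i * \<beta>) (real i * \<gamma>)"
    by (simp add: scaleR_right_distrib flip: distrib_left)
  then show "\<exists>i \<alpha> \<beta> \<gamma>. ?Q i \<alpha> \<beta> \<gamma>" by blast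
next
  assume "\<exists>i \<alpha> \<beta> \<gamma>. ?Q i \<alpha> \<beta> \<gamma>"
  then obtain i \<alpha> \<beta> \<gamma> where Q: "?Q i \<alpha> \<beta> \<gamma>" by blast
  show "p \<in> convex_body_semigroup (convex hull {u, v, w})"
  \<comment> \<open>Dividing the weights by \<open>i\<close> fails for \<open>i = 0\<close>; then
    all weights vanish and the point is zero times a vertex.\<close>
  proof (cases "i = 0")
    case True
    with Q have "\<alpha> = 0" "\<beta> = 0" "\<gamma> = 0" by auto
    with Q have "(real (fst p), real (snd p)) = real 0 *\<^sub>R u" by simp
    moreover have "u \<in> convex hull {u, v, w}" by (simp add: hull_inc)
    ultimately show ?thesis unfolding convex_body_semigroup_def by blast
  next
    case False
    define x where "x = (\<alpha> / i) *\<^sub>R u + (\<beta> / i) *\<^sub>R v + (\<gamma> / i) *\<^sub>R w"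
    have "x \<in> convex hull {u, v, w}"
      unfolding convex_hull_3 x_def using Q False
      by (intro CollectI exI[of _ "\<alpha> / i"] exI[of _ "\<beta> / i"] exI[of _ "\<gamma> / i"])
        (auto simp flip: add_divide_distrib)
    moreover have "(real (fst p), real (snd p)) = real i *\<^sub>R x"
      using Q False by (simp add: x_def scaleR_right_distrib)
    ultimately show ?thesis unfolding convex_body_semigroup_def by blast
  qed
qed

lemma independent_coordinates_unique:
  assumes "cross u v \<noteq> 0" "s *\<^sub>R u + t *\<^sub>R v = s' *\<^sub>R u + t' *\<^sub>R v"
  shows "s = s' \<and> t = t'"
proof -
  have e: "(s - s') * fst u + (t - t') * fst v = 0" "(s - s') * snd u + (t - t') * snd v = 0"
    using assms(2) by (auto simp: prod_eq_iff algebra_simps)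
  have "(s - s') * cross u v =
      ((s - s') * fst u + (t - t') * fst v) * snd v - ((s - s') * snd u + (t - t') * snd v) * fst v"
    by (simp add: cross_def algebra_simps)
  moreover have "(t - t') * cross u v =
      ((s - s') * snd u + (t - t') * snd v) * fst u - ((s - s') * fst u + (t - t') * fst v) * snd u"
    by (simp add: cross_def algebra_simps)
  ultimately show ?thesis using assms(1) unfolding e by simp
qed

text \<open>In coordinates with respect to \<open>u\<close> and \<open>v\<close>, a point with weight \<open>\<gamma>\<close> at the third vertex is
  characterised by two inequalities that become weaker as \<open>\<gamma>\<close> decreases. Hence, of the two
  representations of \<open>x\<close> and \<open>z\<close>, the one with the smaller \<open>\<gamma>\<close> also represents
  \<open>x - j \<star> n2 = z - i \<star> n1\<close>.\<close>

lemma cohen_macaulay_triangle: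
  assumes indep: "cross u v \<noteq> 0" and quad: "u \<in> nonneg_quadrant" "v \<in> nonneg_quadrant"
    and \<sigma>\<tau>: "0 \<le> \<sigma>" "0 \<le> \<tau>" and w: "w = \<sigma> *\<^sub>R u + \<tau> *\<^sub>R v"
    and n1: "(real (fst n1), real (snd n1)) = real k *\<^sub>R u" "k > 0"
    and n2: "(real (fst n2), real (snd n2)) = real l *\<^sub>R v" "l > 0"
  shows "cohen_macaulay_semigroup (convex_body_semigroup (convex hull {u, v, w})) n1 n2"
proof -
  define P where "P = convex_body_semigroup (convex hull {u, v, w})"
  define pt where "pt p = (real (fst p), real (snd p))" for p :: "nat \<times> nat"
  have pt_add: "pt (x + y) = pt x + pt y" for x y by (simp add: pt_def)
  have pt_scale: "pt (i \<star> x) = real i *\<^sub>R pt x" for i x by (simp add: pt_def)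
  have P_iff: "p \<in> P \<longleftrightarrow> (\<exists>(i::nat) \<alpha> \<beta> \<gamma>. 0 \<le> \<alpha> \<and> 0 \<le> \<beta> \<and> 0 \<le> \<gamma> \<and>
      \<alpha> + \<beta> + \<gamma> = real i \<and> pt p = \<alpha> *\<^sub>R u + \<beta> *\<^sub>R v + \<gamma> *\<^sub>R w)" for p
    unfolding P_def pt_def by (rule mem_convex_body_semigroup_triangle)
  have P_coord: "\<exists>(i::nat) \<gamma> s t. 0 \<le> \<gamma> \<and> pt p = s *\<^sub>R u + t *\<^sub>R v \<and>
      s + t = real i + \<gamma> * (\<sigma> + \<tau> - 1) \<and> \<gamma> * \<sigma> \<le> s \<and> \<gamma> * \<tau> \<le> t" if "p \<in> P" for p
  proof -
    from that obtain i :: nat and \<alpha> \<beta> \<gamma> where h: "0 \<le> \<alpha>" "0 \<le> \<beta>" "0 \<le> \<gamma>"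
      "\<alpha> + \<beta> + \<gamma> = real i" "pt p = \<alpha> *\<^sub>R u + \<beta> *\<^sub>R v + \<gamma> *\<^sub>R w"
      unfolding P_iff by blast
    have "pt p = (\<alpha> + \<gamma> * \<sigma>) *\<^sub>R u + (\<beta> + \<gamma> * \<tau>) *\<^sub>R v"
      using h(5) by (simp add: w algebra_simps)
    then show ?thesis using h
      by (intro exI[of _ i] exI[of _ \<gamma>] exI[of _ "\<alpha> + \<gamma> * \<sigma>"] exI[of _ "\<beta> + \<gamma> * \<tau>"])
        (auto simp: algebra_simps)
  qed
  \<comment> \<open>The factor \<open>i\<close> may be any integer here: the two inequalities and
    \<open>0 \<le> \<gamma>\<close> force it to be nonnegative. This allows factors that arise by
    subtraction.\<close>
  have P_of_coord: "p \<in> P" if h: "0 \<le> \<gamma>" "pt p = s *\<^sub>R u + t *\<^sub>R v"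
    "s + t = of_int i + \<gamma> * (\<sigma> + \<tau> - 1)" "\<gamma> * \<sigma> \<le> s" "\<gamma> * \<tau> \<le> t" for p i \<gamma> s t
  proof -
    have "0 \<le> real_of_int i" using h(1,3-5) by (simp add: algebra_simps)
    then have i: "real (nat i) = of_int i" by simp
    show ?thesis unfolding P_iff
      using h by (intro exI[of _ "nat i"] exI[of _ "s - \<gamma> * \<sigma>"] exI[of _ "t - \<gamma> * \<tau>"] exI[of _ \<gamma>])
        (auto simp: w i algebra_simps)
  qed
  show ?thesis unfolding P_def[symmetric]
  proof
    have "0 \<in> P" unfolding P_iff by (intro exI[of _ 0]) (simp add: pt_def zero_prod_def)
    moreover have "x + y \<in> P" if xy: "x \<in> P" "y \<in> P" for x y
    proof -
      obtain i \<alpha> \<beta> \<gamma> where 1: "0 \<le> \<alpha>" "0 \<le> \<beta>" "0 \<le> \<gamma>"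
        "\<alpha> + \<beta> + \<gamma> = real i" "pt x = \<alpha> *\<^sub>R u + \<beta> *\<^sub>R v + \<gamma> *\<^sub>R w"
        using xy(1) unfolding P_iff by blast
      obtain i' \<alpha>' \<beta>' \<gamma>' where 2: "0 \<le> \<alpha>'" "0 \<le> \<beta>'" "0 \<le> \<gamma>'"
        "\<alpha>' + \<beta>' + \<gamma>' = real i'" "pt y = \<alpha>' *\<^sub>R u + \<beta>' *\<^sub>R v + \<gamma>' *\<^sub>R w"
        using xy(2) unfolding P_iff by blast
      show ?thesis unfolding P_iff pt_add
        using 1 2 by (intro exI[of _ "i + i'"] exI[of _ "\<alpha> + \<alpha>'"] exI[of _ "\<beta> + \<beta>'"] exI[of _ "\<gamma> + \<gamma>'"])
          (auto simp: algebra_simps)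
    qed
    ultimately show "add_submonoid P" by (simp add: add_submonoid_def)
    show "n1 \<in> P" unfolding P_iff
      using n1 by (intro exI[of _ k] exI[of _ "real k"] exI[of _ 0]) (simp add: pt_def)
    show "n2 \<in> P" unfolding P_iff
      using n2 by (intro exI[of _ l] exI[of _ 0] exI[of _ "real l"]) (simp add: pt_def)
    show "fst n1 * snd n2 \<noteq> snd n1 * fst n2"
    proof
      assume "fst n1 * snd n2 = snd n1 * fst n2"
      then have "real (fst n1) * real (snd n2) = real (snd n1) * real (fst n2)"
        by (simp flip: of_nat_mult)
      moreover have "real (fst n1) = k * fst u" "real (snd n1) = k * snd u"
        "real (fst n2) = l * fst v" "real (snd n2) = l * snd v"
        using n1 n2 by (auto simp: prod_eq_iff)
      ultimately have "real k * real l * cross u v = 0"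
        by (simp add: cross_def algebra_simps)
      then show False using indep n1 n2 by simp
    qed
    fix x z i j assume xz: "x \<in> P" "z \<in> P" "x + i \<star> n1 = z + j \<star> n2"
    obtain a :: nat and \<gamma> s t where x: "0 \<le> \<gamma>" "pt x = s *\<^sub>R u + t *\<^sub>R v"
      "s + t = real a + \<gamma> * (\<sigma> + \<tau> - 1)" "\<gamma> * \<sigma> \<le> s" "\<gamma> * \<tau> \<le> t"
      using P_coord[OF xz(1)] by blast
    obtain a' :: nat and \<gamma>' s' t' where z: "0 \<le> \<gamma>'" "pt z = s' *\<^sub>R u + t' *\<^sub>R v"
      "s' + t' = real a' + \<gamma>' * (\<sigma> + \<tau> - 1)" "\<gamma>' * \<sigma> \<le> s'" "\<gamma>' * \<tau> \<le> t'"
      using P_coord[OF xz(2)] by blast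
    have ptn: "pt n1 = real k *\<^sub>R u" "pt n2 = real l *\<^sub>R v"
      using n1 n2 by (simp_all add: pt_def)
    have "pt x + real i *\<^sub>R pt n1 = pt z + real j *\<^sub>R pt n2"
      using arg_cong[OF xz(3), of pt] by (simp add: pt_add pt_scale)
    then have "(s + real (i * k)) *\<^sub>R u + t *\<^sub>R v = s' *\<^sub>R u + (t' + real (j * l)) *\<^sub>R v"
      by (simp add: x z ptn algebra_simps)
    from independent_coordinates_unique[OF indep this]
    have st: "s + real (i * k) = s'" "t = t' + real (j * l)" by auto
    have nn: "0 \<le> s" "0 \<le> t'"
      using x(1,4) z(1,5) \<sigma>\<tau> by (meson mult_nonneg_nonneg order_trans)+
    have pt_y: "pt x - pt (j \<star> n2) = s *\<^sub>R u + t' *\<^sub>R v"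
      by (simp add: pt_scale x ptn st algebra_simps)
    have "s *\<^sub>R u + t' *\<^sub>R v \<in> nonneg_quadrant"
      using nn quad by (auto simp: nonneg_quadrant_def)
    \<comment> \<open>Neither coordinate of \<open>x - j \<star> n2\<close> is negative, so the
      subtraction of natural numbers that defines \<open>y\<close> is exact.\<close>
    then have "real (fst (j \<star> n2)) \<le> real (fst x)" "real (snd (j \<star> n2)) \<le> real (snd x)"
      unfolding pt_y[symmetric] by (auto simp: nonneg_quadrant_def pt_def)
    then have le: "fst (j \<star> n2) \<le> fst x" "snd (j \<star> n2) \<le> snd x"
      unfolding of_nat_le_iff by auto
    define y where "y = (fst x - fst (j \<star> n2), snd x - snd (j \<star> n2))"
    have y: "x = y + j \<star> n2" unfolding y_def using le by (simp add: prod_eq_iff)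
    have pty: "pt y = s *\<^sub>R u + t' *\<^sub>R v"
      using pt_y by (simp add: y pt_add)
    have "y \<in> P"
    proof (cases "\<gamma> \<le> \<gamma>'")
      case True
      then have "\<gamma> * \<tau> \<le> t'" using z(5) \<sigma>\<tau> by (meson mult_right_mono order_trans)
      \<comment> \<open>Since \<open>n2\<close> is \<open>l\<close> times a vertex, removing
        \<open>j\<close> copies of it lowers the scaling factor by the integer \<open>j * l\<close>;
        in the other case the factor of \<open>z\<close> drops by \<open>i * k\<close>.\<close>
      moreover have "s + t' = of_int (int a - int (j * l)) + \<gamma> * (\<sigma> + \<tau> - 1)"
        using x(3) st by simp
      ultimately show ?thesis using P_of_coord[OF x(1) pty] x by blast
    next
      case False
      then have "\<gamma>' * \<sigma> \<le> s" using x(4) \<sigma>\<tau> by (meson mult_right_mono order_trans linear)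
      moreover have "s + t' = of_int (int a' - int (i * k)) + \<gamma>' * (\<sigma> + \<tau> - 1)"
        using z(3) st by simp
      ultimately show ?thesis using P_of_coord[OF z(1) pty] z by blast
    qed
    with y show "\<exists>y\<in>P. x = y + j \<star> n2" by blast
  qed
qed

lemma cohen_macaulay_rational_triangle:
  assumes "F \<subseteq> nonneg_quadrant" "rational_triangle F"
  obtains n1 n2 where "cohen_macaulay_semigroup (convex_body_semigroup F) n1 n2"
proof -
  obtain a b c where abc: "rational_point a" "rational_point b" "rational_point c"
    "\<not> collinear {a, b, c}" "F = convex hull {a, b, c}"
    using assms(2) unfolding rational_triangle_def by blast
  have quad: "{a, b, c} \<subseteq> nonneg_quadrant"
    using assms(1) hull_subset[of "{a, b, c}" convex] unfolding abc(5) by (rule order_trans[rotated])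
  obtain u v w \<sigma> \<tau> where uvw: "{u, v, w} = {a, b, c}" "cross u v \<noteq> 0"
    "0 \<le> \<sigma>" "0 \<le> \<tau>" "w = \<sigma> *\<^sub>R u + \<tau> *\<^sub>R v"
    by (rule triangle_order[OF quad abc(4)])
  have mem: "u \<in> {a, b, c}" "v \<in> {a, b, c}" unfolding uvw(1)[symmetric] by auto
  then have uv: "rational_point u" "u \<in> nonneg_quadrant" "rational_point v" "v \<in> nonneg_quadrant"
    using abc(1-3) quad by auto
  obtain k n1 where n1: "k > 0" "(real (fst n1), real (snd n1)) = real k *\<^sub>R u"
    by (rule nonneg_rational_point_multiple[OF uv(1,2)])
  obtain l n2 where n2: "l > 0" "(real (fst n2), real (snd n2)) = real l *\<^sub>R v"
    by (rule nonneg_rational_point_multiple[OF uv(3,4)])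
  show thesis
    using that cohen_macaulay_triangle[OF uvw(2) uv(2,4) uvw(3-5) n1(2,1) n2(2,1)]
    unfolding abc(5) uvw(1)[symmetric] .
qed

section \<open>Systems of parameters\<close>

text \<open>If \<open>p\<close> and \<open>q\<close> lie in the radical of \<open>(x\<^sub>1, x\<^sub>2)\<close>, then a fraction \<open>z / x\<^sub>1\<close> with
  \<open>x\<^sub>2 z \<in> (x\<^sub>1)\<close> is multiplied into the ring by powers of both \<open>p\<close> and \<open>q\<close>; as these powers
  form a regular sequence, it lies in the ring itself.\<close>

lemma (in domain) colon_principal_of_regular_radical:
  assumes x: "x1 \<in> carrier R" "x2 \<in> carrier R" "x1 \<noteq> \<zero>"
    and pq: "p \<in> carrier R" "q \<in> carrier R" "p \<noteq> \<zero>"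
    and rad: "p [^] (n::nat) \<in> Idl {x1, x2}" "q [^] (k::nat) \<in> Idl {x1, x2}"
    and regular: "\<And>w w'. \<lbrakk>w \<in> carrier R; w' \<in> carrier R; w \<otimes> q [^] k = w' \<otimes> p [^] n\<rbrakk> \<Longrightarrow>
      \<exists>v\<in>carrier R. w = v \<otimes> p [^] n"
    and a: "a \<in> carrier R" "a \<otimes> x2 \<in> Idl {x1}"
  shows "a \<in> Idl {x1}"
proof -
  have principal: "Idl {x1} = {r \<otimes> x1 | r. r \<in> carrier R}"
    using x cgenideal_eq_genideal[of x1] by (simp add: cgenideal_def)
  obtain z where z: "z \<in> carrier R" "a \<otimes> x2 = z \<otimes> x1" using a(2) principal by auto
  have mult: "\<exists>w\<in>carrier R. s \<otimes> a = w \<otimes> x1" if s: "s \<in> Idl {x1, x2}" for s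
  proof -
    \<comment> \<open>The multipliers that take \<open>a\<close> into the ideal of \<open>x1\<close>
      form an ideal, and it contains both \<open>x1\<close> and \<open>x2\<close>.\<close>
    have "Idl {x1, x2} \<subseteq> {s \<in> carrier R. s \<otimes> a \<in> Idl {x1}}"
    proof (rule genideal_minimal)
      interpret J: ideal "Idl {x1}" R using x by (intro genideal_ideal) auto
      show "ideal {s \<in> carrier R. s \<otimes> a \<in> Idl {x1}} R"
      proof (rule idealI[OF ring_axioms])
        show "subgroup {s \<in> carrier R. s \<otimes> a \<in> Idl {x1}} (add_monoid R)"
          using a(1) additive_subgroup.zero_closed[OF J.is_additive_subgroup]
            additive_subgroup.a_closed[OF J.is_additive_subgroup] J.a_inv_closed
          by (intro group.subgroupI a_group)
            (auto simp: l_distr l_minus simp flip: a_inv_def intro!: exI[of _ \<zero>])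
      next
        fix s r assume "s \<in> {s \<in> carrier R. s \<otimes> a \<in> Idl {x1}}" "r \<in> carrier R"
        then show "r \<otimes> s \<in> {s \<in> carrier R. s \<otimes> a \<in> Idl {x1}}"
          "s \<otimes> r \<in> {s \<in> carrier R. s \<otimes> a \<in> Idl {x1}}"
          using J.I_l_closed[of "s \<otimes> a" r] a(1) by (auto simp: m_ac)
      qed
      have "x1 \<otimes> a \<in> Idl {x1}" using J.I_r_closed[OF genideal_self'[OF x(1)] a(1)] .
      moreover have "x2 \<otimes> a \<in> Idl {x1}" using a(2) unfolding m_comm[OF a(1) x(2)] .
      ultimately show "{x1, x2} \<subseteq> {s \<in> carrier R. s \<otimes> a \<in> Idl {x1}}" using x by simp
    qed
    with s have "s \<otimes> a \<in> Idl {x1}" by auto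
    then show ?thesis unfolding principal by auto
  qed
  obtain w where w: "w \<in> carrier R" "p [^] n \<otimes> a = w \<otimes> x1" using mult[OF rad(1)] by auto
  obtain w' where w': "w' \<in> carrier R" "q [^] k \<otimes> a = w' \<otimes> x1" using mult[OF rad(2)] by auto
  have pc: "p [^] n \<in> carrier R" "q [^] k \<in> carrier R" using pq by auto
  have "x1 \<otimes> (w \<otimes> q [^] k) = (w \<otimes> x1) \<otimes> q [^] k" using w(1) x pc by (simp add: m_ac)
  also have "\<dots> = (q [^] k \<otimes> a) \<otimes> p [^] n" unfolding w(2)[symmetric] using a(1) pc by (simp add: m_ac)
  also have "\<dots> = x1 \<otimes> (w' \<otimes> p [^] n)" unfolding w'(2) using w'(1) x pc by (simp add: m_ac)
  finally have "w \<otimes> q [^] k = w' \<otimes> p [^] n"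
    using x w(1) w'(1) pc m_lcancel[of x1] by simp
  then obtain v where v: "v \<in> carrier R" "w = v \<otimes> p [^] n" using regular w(1) w'(1) by blast
  have "p [^] n \<otimes> a = p [^] n \<otimes> (v \<otimes> x1)"
    unfolding w(2) v(2) using v(1) pc x by (simp add: m_ac)
  moreover have "p [^] n \<noteq> \<zero>" using pq by (induction n) (auto simp: integral_iff)
  ultimately have "a = v \<otimes> x1" using pc a(1) v(1) x by (simp add: m_lcancel)
  then show ?thesis unfolding principal using v(1) by auto
qed

text \<open>For length at most one, cancellation in the domain suffices, apart from a zero
  parameter. For length two the colon ideals are even trivial. Regularity is demanded for all powers
  of \<open>p\<close> and \<open>q\<close>, as the radical condition does not control the
  exponents.\<close>

lemma (in domain) weak_sequence_if_regular_radical: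
  assumes M: "ideal M R" "M \<noteq> carrier R" and sop: "system_of_parameters R M xs"
    and len: "length xs \<le> 2"
    and regular: "length xs = 2 \<Longrightarrow> \<exists>p\<in>M. \<exists>q\<in>M. p \<noteq> \<zero> \<and>
      (\<forall>(n::nat) (k::nat). \<forall>w\<in>carrier R. \<forall>w'\<in>carrier R.
      w \<otimes> q [^] k = w' \<otimes> p [^] n \<longrightarrow> (\<exists>v\<in>carrier R. w = v \<otimes> p [^] n))"
  shows "weak_sequence R M xs"
proof -
  interpret M: ideal M R by fact
  have xs: "set xs \<subseteq> M" and rad: "{y \<in> carrier R. \<exists>n::nat. y [^] n \<in> Idl (set xs)} = M"
    using sop by (auto simp: system_of_parameters_def)
  have zero_ideal: "Idl {} = {\<zero>}"
  proof
    show "Idl {} \<subseteq> {\<zero>}" by (rule genideal_minimal[OF zeroideal]) simp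
    show "{\<zero>} \<subseteq> Idl {}"
      using additive_subgroup.zero_closed[OF ideal.axioms(1)[OF genideal_ideal[of "{}"]]] by simp
  qed
  have pow_zero: "y = \<zero>" if "y [^] (n::nat) = \<zero>" "y \<in> carrier R" for y n
    using that by (induction n) (auto simp: integral_iff)
  have pow_nonzero: "y [^] (n::nat) \<noteq> \<zero>" if "y \<noteq> \<zero>" "y \<in> carrier R" for y n
    using pow_zero that by blast
  consider "xs = []" | x where "xs = [x]" | x1 x2 where "xs = [x1, x2]"
    using len by (cases xs rule: remdups_adj.cases) auto
  then show ?thesis
  proof cases
    case 1
    then show ?thesis by (simp add: weak_sequence_def)
  next
    case (2 x)
    have "y \<otimes> a = \<zero>" if "y \<in> M" "a \<in> carrier R" "a \<otimes> x = \<zero>" for y a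
    proof (cases "x = \<zero>")
      case True
      \<comment> \<open>A zero parameter makes \<open>M\<close> the radical of the zero ideal, which
        is zero in a domain.\<close>
      then have "\<exists>n::nat. y [^] n \<in> {\<zero>}"
        using rad that(1) 2 genideal_zero by auto
      then have "y = \<zero>" using pow_zero M.Icarr[OF that(1)] by blast
      then show ?thesis using that(2) by simp
    next
      case False
      then show ?thesis using that xs 2 M.Icarr by (auto simp: integral_iff)
    qed
    then show ?thesis using 2 by (auto simp: weak_sequence_def colon_def zero_ideal)
  next
    case (3 x1 x2)
    then have x: "x1 \<in> carrier R" "x2 \<in> carrier R" "x2 \<in> M" using xs M.Icarr by auto
    have "length xs = 2" using 3 by simp
    from regular[OF this] obtain p q where pq: "p \<in> M" "q \<in> M" "p \<noteq> \<zero>" and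
      reg: "\<forall>(n::nat) (k::nat). \<forall>w\<in>carrier R. \<forall>w'\<in>carrier R.
        w \<otimes> q [^] k = w' \<otimes> p [^] n \<longrightarrow> (\<exists>v\<in>carrier R. w = v \<otimes> p [^] n)"
      by (elim bexE conjE)
    obtain n k :: nat where nk: "p [^] n \<in> Idl {x1, x2}" "q [^] k \<in> Idl {x1, x2}"
      using rad pq 3 by auto
    have pc: "p \<in> carrier R" "q \<in> carrier R" using pq M.Icarr by auto
    \<comment> \<open>Otherwise powers of \<open>p\<close> and \<open>q\<close> would both be
      multiples of \<open>x2\<close>. Regularity then shows that the cofactor of the power of
      \<open>p\<close> is itself a multiple of that power, which makes \<open>x2\<close> a unit in
      \<open>M\<close>.\<close>
    have "x1 \<noteq> \<zero>"
    proof
      assume "x1 = \<zero>"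
      have sub: "Idl {\<zero>, x2} \<subseteq> PIdl x2"
        using x cgenideal_ideal[of x2] cgenideal_self[of x2]
          additive_subgroup.zero_closed[OF ideal.axioms(1)[OF cgenideal_ideal[of x2]]]
        by (intro genideal_minimal) auto
      obtain g h where gh: "g \<in> carrier R" "p [^] n = g \<otimes> x2" "h \<in> carrier R" "q [^] k = h \<otimes> x2"
        using nk sub unfolding \<open>x1 = \<zero>\<close> cgenideal_def by blast
      have "g \<otimes> q [^] k = h \<otimes> p [^] n" using gh x by (simp add: m_ac)
      then obtain v where v: "v \<in> carrier R" "g = v \<otimes> p [^] n" using reg gh by blast
      have "p [^] n \<otimes> (v \<otimes> x2) = g \<otimes> x2" using v x pc by (simp add: m_ac)
      also have "\<dots> = p [^] n \<otimes> \<one>" unfolding gh(2)[symmetric] using pc by simp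
      finally have "v \<otimes> x2 = \<one>"
        by (rule iffD1[OF m_lcancel[OF pow_nonzero[OF pq(3) pc(1)] nat_pow_closed[OF pc(1)]
            m_closed[OF v(1) x(2)] one_closed]])
      then have "\<one> \<in> M" using M.I_l_closed[OF x(3) v(1)] by simp
      then show False using M.one_imp_carrier M by auto
    qed
    have "y \<otimes> a \<in> Idl {}" if "y \<in> M" "a \<in> colon R (Idl {}) x1" for y a
      using that \<open>x1 \<noteq> \<zero>\<close> x M.Icarr by (auto simp: zero_ideal colon_def integral_iff)
    moreover have "y \<otimes> a \<in> Idl {x1}" if "y \<in> M" "a \<in> colon R (Idl {x1}) x2" for y a
    proof -
      interpret J: ideal "Idl {x1}" R using x by (intro genideal_ideal) auto
      have "a \<in> Idl {x1}"
      proof (rule colon_principal_of_regular_radical[OF x(1,2) \<open>x1 \<noteq> \<zero>\<close> pc pq(3) nk])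
        show "a \<in> carrier R" "a \<otimes> x2 \<in> Idl {x1}" using that(2) by (simp_all add: colon_def)
      qed (rule reg[rule_format])
      then show ?thesis using J.I_l_closed M.Icarr that(1) by blast
    qed
    ultimately show ?thesis
      using 3 by (auto simp: weak_sequence_def less_Suc_eq numeral_2_eq_2)
  qed
qed

text \<open>If all chains were shorter than \<open>d\<close>, the supremum would be at most
  \<open>d - 1\<close>. Positivity keeps this subtraction honest and excludes an empty set of
  chains, whose supremum is also zero.\<close>

lemma prime_chain_of_krull_dim:
  assumes "enat d = krull_dim R" "d > 0"
  obtains n p where "d \<le> n" "prime_chain R n p"
proof (rule ccontr)
  assume "\<not> thesis"
  then have *: "n < d" if "prime_chain R n p" for n p
    using that \<open>\<And>n p. \<lbrakk>d \<le> n; prime_chain R n p\<rbrakk> \<Longrightarrow> thesis\<close> not_le by blast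
  have "krull_dim R \<le> enat (d - 1)"
    unfolding krull_dim_def using * by (intro Sup_least) fastforce
  then have "d \<le> d - 1" unfolding assms(1)[symmetric] by simp
  then show False using assms(2) by simp
qed

text \<open>Distinct multiples of a nonzero \<open>n\<close> are distinct exponents, so a formally
  nonzero polynomial remains nonzero after substituting the monomial.\<close>

lemma ray_polynomial:
  fixes c :: "nat \<Rightarrow> 'k::field"
  assumes "fst n + snd n > 0" "\<exists>k<N. c k \<noteq> 0"
  defines "f \<equiv> \<Sum>k<N. Poly_Mapping.single 0 (c k) * Poly_Mapping.single n 1 ^ k"
  shows "f \<noteq> 0" "f \<in> supported_on (range (\<lambda>i. i \<star> n))"
proof -
  have pow: "Poly_Mapping.single n (1::'k) ^ k = Poly_Mapping.single (k \<star> n) 1" for k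
  proof (induction k)
    case (Suc k)
    then show ?case using nscale_add[of 1 k n] by (simp add: mult_single)
  qed simp
  have f: "f = (\<Sum>k<N. Poly_Mapping.single (k \<star> n) (c k))"
    by (simp add: f_def pow mult_single)
  show "f \<in> supported_on (range (\<lambda>i. i \<star> n))"
    unfolding f by (intro supported_on_sum) auto
  have inj: "i \<star> n = j \<star> n \<longleftrightarrow> i = j" for i j
    using assms(1) by (auto simp: prod_eq_iff)
  obtain k where k: "k < N" "c k \<noteq> 0" using assms(2) by blast
  have "Poly_Mapping.lookup f (k \<star> n) = c k"
    using k by (simp add: f lookup_sum lookup_single when_def inj)
  with k show "f \<noteq> 0" by auto
qed

text \<open>Keeps powers of a polynomial in \<open>t^n\<close> supported on the same ray, so the
  division lemma covers all powers.\<close>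

lemma submonoid_ray: "add_submonoid (range (\<lambda>i. i \<star> n))"
  unfolding add_submonoid_def
  by (auto simp flip: nscale_add) (metis nscale_0 rangeI)

section \<open>The local rings of the semigroup ring\<close>

context cohen_macaulay_semigroup begin

lemma buchsbaum_localization:
  fixes m :: "((nat \<times> nat) \<Rightarrow>\<^sub>0 'k::field) set"
  assumes m: "maximalideal m (semigroup_ring P)"
  shows "buchsbaum_local_ring (localization (semigroup_ring P) (carrier (semigroup_ring P) - m))"
proof -
  define R where "R = (semigroup_ring P :: ((nat \<times> nat) \<Rightarrow>\<^sub>0 'k) ring)"
  have R_sel: "x \<otimes>\<^bsub>R\<^esub> y = x * y" "x \<oplus>\<^bsub>R\<^esub> y = x + y" "\<one>\<^bsub>R\<^esub> = 1" "\<zero>\<^bsub>R\<^esub> = 0"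
    "x [^]\<^bsub>R\<^esub> (i::nat) = x ^ i" for x y i by (simp_all add: R_def)
  have car: "carrier R = supported_on P" unfolding R_def by (rule carrier_semigroup_ring[OF submonoid])
  interpret R: domain R unfolding R_def by (rule domain_semigroup_ring[OF submonoid])
  interpret m: maximalideal m R using m by (simp add: R_def)
  interpret pm: primeideal m R by (rule R.maximalideal_prime[OF m.is_maximalideal])
  define S where "S = carrier R - m"
  interpret domain_fractions R S unfolding S_def by (rule pm.domain_fractions_compl[OF R.domain_axioms])
  interpret L: domain Loc by (rule domain_localization)
  obtain M where M: "maximalideal M Loc" "\<And>J. ideal J Loc \<Longrightarrow> J \<noteq> carrier Loc \<Longrightarrow> J \<subseteq> M"
    and M_def: "M = {frac a s | a s. a \<in> m \<and> s \<in> S}"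
    using local_maximal_ideal[OF m.is_ideal S_def] by blast
  interpret M: maximalideal M Loc by (rule M(1))
  have unique: "J = M" if J: "maximalideal J Loc" for J
  proof -
    interpret J: maximalideal J Loc by fact
    have "J \<subseteq> M" using M(2) J.is_ideal J.I_notcarr by blast
    then show ?thesis
      using J.I_maximal[OF M.is_ideal] M.I_notcarr M.Icarr by blast
  qed
  have chain: "primeideal (contraction (p i)) (semigroup_ring P)" if "prime_chain Loc n p" "i \<le> n" for n p i
    using that primeideal_contraction[of "p i"] by (simp add: prime_chain_def R_def)
  have chain_less: "contraction (p i) \<subset> contraction (p (Suc i))" if "prime_chain Loc n p" "i < n" for n p i
    using that by (intro contraction_mono_strict) (auto simp: prime_chain_def primeideal_def)
  have "weak_sequence Loc M xs" if sop: "system_of_parameters Loc M xs" for xs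
  proof (rule L.weak_sequence_if_regular_radical[OF M.is_ideal _ sop])
    show "M \<noteq> carrier Loc" using M.I_notcarr by simp
    have dim: "enat (length xs) = krull_dim Loc" using sop by (simp add: system_of_parameters_def)
    show "length xs \<le> 2"
    proof (rule ccontr)
      assume "\<not> length xs \<le> 2"
      then obtain n p where "length xs \<le> n" and p: "prime_chain Loc n p"
        using prime_chain_of_krull_dim[OF dim] by (metis not_le_imp_less not_less_zero neq0_conv zero_le)
      with \<open>\<not> length xs \<le> 2\<close> have n: "3 \<le> n" by linarith
      show False
        using no_prime_chain_three[OF submonoid chain[OF p, of 0] chain[OF p, of 1]
            chain[OF p, of 2] chain[OF p, of 3]]
          chain_less[OF p, of 0] chain_less[OF p, of 1] chain_less[OF p, of 2] n
        by (simp add: numeral_2_eq_2 numeral_3_eq_3)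
    qed
    assume len: "length xs = 2"
    then have "length xs > 0" by simp
    then obtain n p where "length xs \<le> n" and p: "prime_chain Loc n p"
      by (rule prime_chain_of_krull_dim[OF dim])
    then have n: "2 \<le> n" using len by simp
    have "primeideal (p 2) Loc" using p n by (simp add: prime_chain_def)
    then interpret p2: primeideal "p 2" Loc .
    \<comment> \<open>A proper ideal of the localization contracts to an ideal that misses the
      complement of \<open>m\<close>. The polynomials found in the contraction therefore lie in
      \<open>m\<close>, whether or not \<open>m\<close> contains monomials.\<close>
    have p2m: "contraction (p 2) \<subseteq> m"
      using contraction_disjoint[OF p2.is_ideal p2.I_notcarr[symmetric]]
        ideal.Icarr[OF ideal_contraction[OF p2.is_ideal]] unfolding S_def by blast
    have chain012: "primeideal (contraction (p 0)) (semigroup_ring P)"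
      "primeideal (contraction (p 1)) (semigroup_ring P)" "primeideal (contraction (p 2)) (semigroup_ring P)"
      using chain[OF p] n by simp_all
    have less012: "contraction (p 0) \<subset> contraction (p 1)" "contraction (p 1) \<subset> contraction (p 2)"
      using chain_less[OF p, of 0] chain_less[OF p, of 1] n by (simp_all add: numeral_2_eq_2)
    have polynomial_in_m: "\<exists>f\<in>m. f \<noteq> 0 \<and> f \<in> supported_on (range (\<lambda>i. i \<star> n'))"
      if n': "n' \<in> P" "fst n' + snd n' > 0" for n'
    proof -
      have "Poly_Mapping.single n' (1::'k) \<in> supported_on P" using n' by simp
      then obtain N c where c: "\<exists>k<N. c k \<noteq> 0"
        "(\<Sum>k<N. Poly_Mapping.single 0 (c k) * Poly_Mapping.single n' 1 ^ k) \<in> contraction (p 2)"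
        by (rule prime_chain_contains_polynomial[OF submonoid chain012 less012])
      with p2m ray_polynomial[OF n'(2) c(1)] show ?thesis by blast
    qed
    obtain f where f: "f \<in> m" "f \<noteq> 0" "f \<in> supported_on (range (\<lambda>i. i \<star> n1))"
      using polynomial_in_m[OF n1 generators_nonzero(1)] by blast
    obtain g where g: "g \<in> m" "g \<noteq> 0" "g \<in> supported_on (range (\<lambda>i. i \<star> n2))"
      using polynomial_in_m[OF n2 generators_nonzero(2)] by blast
    have fgc: "f \<in> carrier R" "g \<in> carrier R" using f g m.Icarr by auto
    have oneS: "\<one>\<^bsub>R\<^esub> \<in> S" by (rule one_S)
    have fgM: "frac f \<one>\<^bsub>R\<^esub> \<in> M" "frac g \<one>\<^bsub>R\<^esub> \<in> M" using f g oneS by (auto simp: M_def)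
    have g0: "frac g \<one>\<^bsub>R\<^esub> \<noteq> \<zero>\<^bsub>Loc\<^esub>" using g fgc oneS by (simp add: fraction_eq_zero_iff R_sel)
    have regular: "\<exists>v\<in>carrier Loc. w = v \<otimes>\<^bsub>Loc\<^esub> frac g \<one>\<^bsub>R\<^esub> [^]\<^bsub>Loc\<^esub> n"
      if w: "w \<in> carrier Loc" "w' \<in> carrier Loc"
        "w \<otimes>\<^bsub>Loc\<^esub> frac f \<one>\<^bsub>R\<^esub> [^]\<^bsub>Loc\<^esub> k =
          w' \<otimes>\<^bsub>Loc\<^esub> frac g \<one>\<^bsub>R\<^esub> [^]\<^bsub>Loc\<^esub> n" for w w' and n k :: nat
    proof -
      obtain \<alpha> s where \<alpha>: "\<alpha> \<in> carrier R" "s \<in> S" "w = frac \<alpha> s" using w(1) by (rule localization_cases)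
      obtain \<beta> t where \<beta>: "\<beta> \<in> carrier R" "t \<in> S" "w' = frac \<beta> t" using w(2) by (rule localization_cases)
      have fg: "f ^ k \<in> carrier R" "g ^ n \<in> carrier R"
        using R.nat_pow_closed[OF fgc(1), of k] R.nat_pow_closed[OF fgc(2), of n] by (simp_all add: R_sel)
      have st: "s \<in> carrier R" "t \<in> carrier R" using \<alpha> \<beta> S_closed by auto
      have mc: "x * y \<in> carrier R" if "x \<in> carrier R" "y \<in> carrier R" for x y
        using R.m_closed[OF that] by (simp add: R_sel)
      have S1: "1 \<in> S" using oneS by (simp add: R_sel)
      have pows: "frac f \<one>\<^bsub>R\<^esub> [^]\<^bsub>Loc\<^esub> k = frac (f ^ k) 1" "frac g \<one>\<^bsub>R\<^esub> [^]\<^bsub>Loc\<^esub> n = frac (g ^ n) 1"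
        using pow_fraction_one fgc by (simp_all add: R_sel)
      have "frac (\<alpha> * f ^ k) s = frac (\<beta> * g ^ n) t"
        using w(3) unfolding \<alpha>(3) \<beta>(3) pows mult_fraction[OF \<alpha>(1,2) fg(1) S1]
          mult_fraction[OF \<beta>(1,2) fg(2) S1] by (simp add: R_sel)
      \<comment> \<open>Clearing denominators moves the equation into the semigroup ring, where
        division by the power of \<open>g\<close> takes place; the denominators reappear as the unit
        \<open>s * t\<close>.\<close>
      then have "(\<alpha> * t) * f ^ k = (\<beta> * s) * g ^ n"
        using \<alpha> \<beta> fg by (simp add: fraction_eq_iff mc R_sel mult_ac)
      moreover have "f ^ k \<noteq> 0" "g ^ n \<noteq> 0" using f g by (simp_all add: poly_mapping_power_eq_0_iff)
      moreover have "\<alpha> * t \<in> supported_on P" "\<beta> * s \<in> supported_on P"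
        using mc \<alpha>(1) \<beta>(1) st by (simp_all flip: car)
      ultimately have "\<exists>\<gamma>\<in>supported_on P. \<alpha> * t = \<gamma> * g ^ n"
        by (intro dvd_of_mult_eq_mult[OF supported_on_power[OF submonoid_ray f(3)] _
            supported_on_power[OF submonoid_ray g(3)]])
      then obtain \<gamma> where \<gamma>: "\<gamma> \<in> supported_on P" "\<alpha> * t = \<gamma> * g ^ n" by blast
      have sts: "s * t \<in> S" using mult_S[OF \<alpha>(2) \<beta>(2)] by (simp add: R_sel)
      have "w = frac (\<alpha> * t) (s * t)"
        unfolding \<alpha>(3) using \<alpha> sts st by (simp add: fraction_eq_iff mc R_sel mult_ac)
      also have "\<dots> = frac \<gamma> (s * t) \<otimes>\<^bsub>Loc\<^esub> frac (g ^ n) 1"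
        using \<gamma> fg sts S1 by (simp add: mult_fraction R_sel car)
      finally show ?thesis unfolding pows
        using \<gamma>(1) sts by (intro bexI[of _ "frac \<gamma> (s * t)"] fraction_closed) (simp_all add: car)
    qed
    \<comment> \<open>The divisor \<open>p\<close> is the fraction of \<open>g\<close>, on the ray
      of \<open>n2\<close>, and \<open>q\<close> is that of \<open>f\<close>, on the ray of
      \<open>n1\<close>; this matches the direction of the division lemma.\<close>
    show "\<exists>p\<in>M. \<exists>q\<in>M. p \<noteq> \<zero>\<^bsub>Loc\<^esub> \<and> (\<forall>(n::nat) (k::nat). \<forall>w\<in>carrier Loc. \<forall>w'\<in>carrier Loc.
        w \<otimes>\<^bsub>Loc\<^esub> q [^]\<^bsub>Loc\<^esub> k = w' \<otimes>\<^bsub>Loc\<^esub> p [^]\<^bsub>Loc\<^esub> n \<longrightarrow>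
        (\<exists>v\<in>carrier Loc. w = v \<otimes>\<^bsub>Loc\<^esub> p [^]\<^bsub>Loc\<^esub> n))"
      by (rule bexI[OF _ fgM(2)], rule bexI[OF _ fgM(1)]) (intro conjI allI ballI impI g0 regular)
  qed
  moreover have "noetherian_ring R"
    unfolding R_def by (rule noetherian_semigroup_ring[OF submonoid divisor_finite])
  ultimately have "buchsbaum_local_ring Loc"
    using M(1) unique noetherian_localization cring_localization
    unfolding buchsbaum_local_ring_def by metis
  then show ?thesis by (simp add: R_def S_def)
qed

lemma buchsbaum: "buchsbaum_semigroup TYPE('k::field) P"
proof -
  interpret domain "semigroup_ring P :: ((nat \<times> nat) \<Rightarrow>\<^sub>0 'k) ring"
    by (rule domain_semigroup_ring[OF submonoid])
  show ?thesis
    unfolding buchsbaum_semigroup_def buchsbaum_ring_def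
    using affine is_cring noetherian_semigroup_ring[OF submonoid divisor_finite] buchsbaum_localization
    by blast
qed

end

theorem corollary8:
  fixes F :: "(real \<times> real) set"
  assumes "F \<subseteq> nonneg_quadrant" and "rational_triangle F"
  shows "buchsbaum_semigroup TYPE('k::field) (convex_body_semigroup F)"
proof -
  obtain n1 n2 where "cohen_macaulay_semigroup (convex_body_semigroup F) n1 n2"
    by (rule cohen_macaulay_rational_triangle[OF assms])
  then show ?thesis by (rule cohen_macaulay_semigroup.buchsbaum)
qed

end
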